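(* Let $S$ be a finite set and let $M=(m_{s,t})_{s,t\in S}$ be a small, triangle-free Coxeter matrix, with associated Coxeter group $W$, Artin group $B$, and pure Artin group $P=\mathrm{Ker}(B\to W)$. If the Paris representation $\Psi : B\to \mathrm{GL}(V)$ is faithful (i.e. injective), then the group $P$ is residually torsion-free nilpotent.
   Context: Residual property: a group $G$ is residually torsion-free nilpotent if for every $g\in G\setminus\{1\}$ there is a surjective homomorphism $\pi:G\to Q$ onto a torsion-free nilpotent group $Q$ with $\pi(g)\neq 1$. Coxeter and Artin groups: $S$ is a finite set. A Coxeter matrix on $S$ is a matrix $M=(m_{s,t})_{s,t\in S}$ with $m_{s,s}=1$ and $m_{s,t}=m_{t,s}\in\{2,3,\dots,\infty\}$ for $s\ne t$. It is small if $m_{s,t}\in\{2,3\}$ for all $s\neq t$, and triangle-free if there is no triple $(s,t,r)$ in $S$ such that $m_{s,t},m_{t,r},m_{r,s}$ are all greater than $2$. For $M$ small, $W$ is the group with generators $S$ and relations $s^2=1$ ($s\in S$), $(st)^{m_{s,t}}=1$ ($s,t\in S$). The Artin group $B$ has generators $\sigma_s$ ($s\in S$) and relations $\sigma_s\sigma_t\sigma_s\cdots=\sigma_t\sigma_s\sigma_t\cdots$ ($m_{s,t}$ factors on each side) for $s\ne t$. The map $\sigma_s\mapsto s$ defines a surjection $B\to W$ whose kernel is the pure Artin group $P$. Roots: let $U$ be the real vector space with basis $\{\alpha_s : s\in S\}$ and symmetric bilinear form $\langle\alpha_s,\alpha_t\rangle=-2\cos(\pi/m_{s,t})$ (so $\langle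 \alpha_s,\alpha_s\rangle=2$, and $\langle\alpha_s,\alpha_t\rangle\in\{0,-1\}$ for $s\ne t$ when $M$ is small). $W$ acts on $U$ by $s(x)=x-\langle\alpha_s,x\rangle\alpha_s$. Let $\Phi=\{w\alpha_s : w\in W, s\in S\}$, let $\Phi^+$ be the set of elements of $\Phi$ all of whose coordinates in the basis $(\alpha_s)$ are $\ge 0$, and $\Phi^-=-\Phi^+$. With $\ell$ the length function on $W$ with respect to $S$, the depth of $\beta\in\Phi^+$ is $dp(\beta)=\min\{\ell(w) : w\in W,\ w\beta\in\Phi^-\}$. Polynomials $T(s,\beta)\in\mathbf{Q}[y]$, for $s\in S$, $\beta\in\Phi^+$, are defined by induction on $dp(\beta)$. If $dp(\beta)=1$, i.e. $\beta=\alpha_t$ with $t\in S$: $T(s,\alpha_s)=y^2$, and $T(s,\alpha_t)=0$ if $t\neq s$. If $dp(\beta)\ge2$, choose $t\in S$ with $dp(t\beta)=dp(\beta)-1$ and set $b=\langle\alpha_t,\beta\rangle$, which is necessarily $>0$; it is known that the following does not depend on the choice of $t$: - if $\langle\alpha_s,\beta\rangle>0$: $T(s,\beta)=y^{dp(\beta)}(y-1)$; - if $\langle\alpha_s,\beta\rangle=0$ and $\langle\alpha_s,\alpha_t\rangle=0$: $T(s,\beta)=yT(s,\beta-b\alpha_t)$; - if $\langle\alpha_s,\beta\rangle=0$ and $\langle\alpha_s,\alpha_t\rangle=-1$: $T(s,\beta)=(y-1)T(s,\beta-b\alpha_t)+yT(t,\beta-b\alpha_s-b\alpha_t)$; - if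 $\langle\alpha_s,\beta\rangle=-a<0$ and $\langle\alpha_s,\alpha_t\rangle=0$: $T(s,\beta)=yT(s,\beta-b\alpha_t)$; - if $\langle\alpha_s,\beta\rangle=-a<0$, $\langle\alpha_s,\alpha_t\rangle=-1$ and $b>a$: $T(s,\beta)=(y-1)T(s,\beta-b\alpha_t)+yT(t,\beta-(b-a)\alpha_s-b\alpha_t)$; - if $\langle\alpha_s,\beta\rangle=-a<0$, $\langle\alpha_s,\alpha_t\rangle=-1$ and $b=a$: $T(s,\beta)=T(t,\beta-b\alpha_t)+(y-1)T(s,\beta-b\alpha_t)$; - if $\langle\alpha_s,\beta\rangle=-a<0$, $\langle\alpha_s,\alpha_t\rangle=-1$ and $b<a$: $T(s,\beta)=yT(s,\beta-b\alpha_t)+T(t,\beta-b\alpha_t)+y^{dp(\beta)-1}(1-y)$. Paris representation: let $V$ be the free $\mathbf{Q}[x,y,x^{-1},y^{-1}]$-module with basis $\{e_\beta:\beta\in\Phi^+\}$. For $s\in S$ define $\varphi_s:V\to V$ linear by: $\varphi_s(e_{\alpha_s})=0$; $\varphi_s(e_\beta)=e_\beta$ if $\langle\alpha_s,\beta\rangle=0$; $\varphi_s(e_\beta)=y\,e_{\beta-a\alpha_s}$ if $\langle\alpha_s,\beta\rangle=a>0$ and $\beta\ne\alpha_s$; $\varphi_s(e_\beta)=(1-y)e_\beta+e_{\beta+a\alpha_s}$ if $\langle\alpha_s,\beta\rangle=-a<0$. Set $\psi_s(e_\beta)=\varphi_s(e_\beta)+x\,T(s,\beta)\,e_{\alpha_s}$.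 It is known that $\sigma_s\mapsto\psi_s$ defines a group homomorphism $\Psi:B\to\mathrm{GL}(V)$ when $M$ is small and triangle-free; this is the Paris representation. *)

theory Defs
  imports
    Complex_Main
    "HOL-Library.Poly_Mapping"
    "HOL-Library.Product_Plus"
    "HOL-Library.Extended_Nat"
    "HOL-Computational_Algebra.Polynomial"
    "HOL-Algebra.Generated_Groups"
    "HOL-Algebra.Bij"
begin

section \<open>Residually torsion-free nilpotent groups\<close>

definition torsion_free_group :: "('a, 'b) monoid_scheme \<Rightarrow> bool" where
  "torsion_free_group G \<longleftrightarrow> group G \<and>
     (\<forall>g\<in>carrier G. \<forall>n::nat. 0 < n \<and> g [^]\<^bsub>G\<^esub> n = \<one>\<^bsub>G\<^esub> \<longrightarrow> g = \<one>\<^bsub>G\<^esub>)"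

primrec lower_central :: "('a, 'b) monoid_scheme \<Rightarrow> nat \<Rightarrow> 'a set" where
  "lower_central G 0 = carrier G"
| "lower_central G (Suc n) = generate G
     (\<Union>h\<in>lower_central G n. \<Union>g\<in>carrier G. {h \<otimes>\<^bsub>G\<^esub> g \<otimes>\<^bsub>G\<^esub> inv\<^bsub>G\<^esub> h \<otimes>\<^bsub>G\<^esub> inv\<^bsub>G\<^esub> g})"

definition nilpotent_group :: "('a, 'b) monoid_scheme \<Rightarrow> bool" where
  "nilpotent_group G \<longleftrightarrow> group G \<and> (\<exists>n. lower_central G n = {\<one>\<^bsub>G\<^esub>})"

text \<open>
  HOL cannot quantify over the type in which the elements of \<open>Q\<close> live. This is no restriction: up to
  isomorphism every homomorphic image of \<open>G\<close> is a quotient \<open>G Mod N\<close>, whose elements are cosets and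
  so have type \<^typ>\<open>'a set\<close>.
\<close>
definition residually_torsion_free_nilpotent :: "('a, 'b) monoid_scheme \<Rightarrow> bool" where
  "residually_torsion_free_nilpotent G \<longleftrightarrow> group G \<and>
     (\<forall>g\<in>carrier G - {\<one>\<^bsub>G\<^esub>}. \<exists>(Q :: 'a set monoid) \<pi>.
        torsion_free_group Q \<and> nilpotent_group Q \<and> \<pi> \<in> epi G Q \<and> \<pi> g \<noteq> \<one>\<^bsub>Q\<^esub>)"


section \<open>Groups given by generators and relations\<close>

text \<open>
  The letter \<open>(s, True)\<close> stands for the generator \<open>s\<close> and \<open>(s, False)\<close> for its inverse. A pair
  \<open>(u, v) \<in> R\<close> stands for the relation \<open>u = v\<close>.
\<close>
type_synonym 's gword = "('s \<times> bool) list"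

definition gwords :: "'s set \<Rightarrow> 's gword set" where
  "gwords S = lists (S \<times> UNIV)"

definition pos_word :: "'s list \<Rightarrow> 's gword" where
  "pos_word = map (\<lambda>s. (s, True))"

inductive pres_eq :: "'s set \<Rightarrow> ('s gword \<times> 's gword) set \<Rightarrow> 's gword \<Rightarrow> 's gword \<Rightarrow> bool"
  for S R where
  refl: "w \<in> gwords S \<Longrightarrow> pres_eq S R w w"
| sym: "pres_eq S R u v \<Longrightarrow> pres_eq S R v u"
| trans: "pres_eq S R u v \<Longrightarrow> pres_eq S R v w \<Longrightarrow> pres_eq S R u w"
| append: "pres_eq S R u v \<Longrightarrow> pres_eq S R u' v' \<Longrightarrow> pres_eq S R (u @ u') (v @ v')"
| cancel: "s \<in> S \<Longrightarrow> pres_eq S R [(s, b), (s, \<not> b)] []"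
| rel: "(u, v) \<in> R \<Longrightarrow> u \<in> gwords S \<Longrightarrow> v \<in> gwords S \<Longrightarrow> pres_eq S R u v"

definition pres_class :: "'s set \<Rightarrow> ('s gword \<times> 's gword) set \<Rightarrow> 's gword \<Rightarrow> 's gword set" where
  "pres_class S R w = {v. pres_eq S R w v}"

definition presented_group :: "'s set \<Rightarrow> ('s gword \<times> 's gword) set \<Rightarrow> 's gword set monoid" where
  "presented_group S R =
     \<lparr>carrier = pres_class S R ` gwords S,
      mult = (\<lambda>X Y. \<Union>u\<in>X. \<Union>v\<in>Y. pres_class S R (u @ v)),
      one = pres_class S R []\<rparr>"

lemma gwords_simps [simp]:
  "[] \<in> gwords S" "a # w \<in> gwords S \<longleftrightarrow> fst a \<in> S \<and> w \<in> gwords S"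
  "u @ v \<in> gwords S \<longleftrightarrow> u \<in> gwords S \<and> v \<in> gwords S"
  by (auto simp: gwords_def mem_Times_iff)

lemma pos_word_simps [simp]:
  "pos_word [] = []" "pos_word (s # w) = (s, True) # pos_word w"
  "pos_word (u @ v) = pos_word u @ pos_word v" "pos_word w \<in> gwords S \<longleftrightarrow> set w \<subseteq> S"
  by (auto simp: pos_word_def gwords_def)

lemma gwords_inverse: "w \<in> gwords S \<Longrightarrow> rev (map (apsnd Not) w) \<in> gwords S"
  by (induction w) auto

lemma pres_eq_gwords: "pres_eq S R u v \<Longrightarrow> u \<in> gwords S \<and> v \<in> gwords S"
  by (induction rule: pres_eq.induct) auto

lemma pres_class_eq_iff:
  "u \<in> gwords S \<Longrightarrow> pres_class S R u = pres_class S R v \<longleftrightarrow> pres_eq S R u v"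
  unfolding pres_class_def set_eq_iff mem_Collect_eq
  by (metis pres_eq.refl pres_eq.sym pres_eq.trans)

lemma mult_pres_class:
  assumes "u \<in> gwords S" "v \<in> gwords S"
  shows "pres_class S R u \<otimes>\<^bsub>presented_group S R\<^esub> pres_class S R v = pres_class S R (u @ v)"
proof -
  have "pres_class S R (u' @ v') = pres_class S R (u @ v)"
    if "u' \<in> pres_class S R u" "v' \<in> pres_class S R v" for u' v'
  proof -
    have "pres_eq S R (u @ v) (u' @ v')"
      using that by (intro pres_eq.append) (auto simp: pres_class_def)
    then show ?thesis
      using assms pres_class_eq_iff[of "u @ v" S R "u' @ v'"] by simp
  qed
  moreover have "u \<in> pres_class S R u" "v \<in> pres_class S R v"
    using assms by (simp_all add: pres_class_def pres_eq.refl)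
  ultimately have "(\<Union>u'\<in>pres_class S R u. \<Union>v'\<in>pres_class S R v. pres_class S R (u' @ v'))
      = pres_class S R (u @ v)"
    by blast
  then show ?thesis
    by (simp add: presented_group_def)
qed

lemma pres_eq_inverse:
  "w \<in> gwords S \<Longrightarrow> pres_eq S R (rev (map (apsnd Not) w) @ w) []"
proof (induction w)
  case (Cons a w)
  obtain s b where a: "a = (s, b)" by force
  have "rev (map (apsnd Not) w) \<in> gwords S"
    using Cons.prems by (simp add: gwords_inverse)
  moreover have "pres_eq S R [(s, \<not> b), (s, b)] []"
    using pres_eq.cancel[of s S R "\<not> b"] Cons.prems a by simp
  ultimately have "pres_eq S R (rev (map (apsnd Not) w) @ [(s, \<not> b), (s, b)] @ w)
      (rev (map (apsnd Not) w) @ [] @ w)"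
    using Cons.prems by (intro pres_eq.append pres_eq.refl) auto
  moreover have "pres_eq S R (rev (map (apsnd Not) w) @ w) []"
    using Cons by simp
  ultimately show ?case
    using pres_eq.trans by (fastforce simp: a)
qed (simp add: pres_eq.refl)

lemma group_presented_group: "group (presented_group S R)"
proof (rule groupI)
  fix X assume "X \<in> carrier (presented_group S R)"
  then obtain w where w: "w \<in> gwords S" "X = pres_class S R w"
    by (auto simp: presented_group_def)
  have inv: "rev (map (apsnd Not) w) \<in> gwords S"
    using w by (simp add: gwords_inverse)
  show "\<one>\<^bsub>presented_group S R\<^esub> \<otimes>\<^bsub>presented_group S R\<^esub> X = X"
    using mult_pres_class[of "[]" S w R] w by (simp add: presented_group_def)
  have "pres_class S R (rev (map (apsnd Not) w)) \<otimes>\<^bsub>presented_group S R\<^esub> X = \<one>\<^bsub>presented_group S R\<^esub>"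
    using mult_pres_class[OF inv w(1), of R] inv w pres_eq_inverse[OF w(1), of R]
      pres_class_eq_iff[of "rev (map (apsnd Not) w) @ w" S R "[]"]
    by (simp add: presented_group_def)
  then show "\<exists>Y\<in>carrier (presented_group S R).
      Y \<otimes>\<^bsub>presented_group S R\<^esub> X = \<one>\<^bsub>presented_group S R\<^esub>"
    using inv by (force simp: presented_group_def)
next
  fix X Y assume "X \<in> carrier (presented_group S R)" "Y \<in> carrier (presented_group S R)"
  then show "X \<otimes>\<^bsub>presented_group S R\<^esub> Y \<in> carrier (presented_group S R)"
    by (smt (verit) gwords_simps(3) image_iff monoid.select_convs(1) mult_pres_class presented_group_def
        partial_object.select_convs(1))
next
  fix X Y Z assume "X \<in> carrier (presented_group S R)" "Y \<in> carrier (presented_group S R)"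
    "Z \<in> carrier (presented_group S R)"
  then obtain u v w where "u \<in> gwords S" "v \<in> gwords S" "w \<in> gwords S"
    "X = pres_class S R u" "Y = pres_class S R v" "Z = pres_class S R w"
    by (auto simp: presented_group_def)
  then show "X \<otimes>\<^bsub>presented_group S R\<^esub> Y \<otimes>\<^bsub>presented_group S R\<^esub> Z
      = X \<otimes>\<^bsub>presented_group S R\<^esub> (Y \<otimes>\<^bsub>presented_group S R\<^esub> Z)"
    by (simp add: mult_pres_class)
qed (auto simp: presented_group_def)


section \<open>Coxeter matrices, Coxeter groups and Artin groups\<close>

definition coxeter_matrix :: "'s set \<Rightarrow> ('s \<Rightarrow> 's \<Rightarrow> enat) \<Rightarrow> bool" where
  "coxeter_matrix S M \<longleftrightarrow> (\<forall>s\<in>S. M s s = 1) \<and>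
     (\<forall>s\<in>S. \<forall>t\<in>S. s \<noteq> t \<longrightarrow> M s t = M t s \<and> 2 \<le> M s t)"

definition small_matrix :: "'s set \<Rightarrow> ('s \<Rightarrow> 's \<Rightarrow> enat) \<Rightarrow> bool" where
  "small_matrix S M \<longleftrightarrow> (\<forall>s\<in>S. \<forall>t\<in>S. s \<noteq> t \<longrightarrow> M s t \<in> {2, 3})"

definition triangle_free_matrix :: "'s set \<Rightarrow> ('s \<Rightarrow> 's \<Rightarrow> enat) \<Rightarrow> bool" where
  "triangle_free_matrix S M \<longleftrightarrow>
     \<not> (\<exists>s\<in>S. \<exists>t\<in>S. \<exists>r\<in>S. 2 < M s t \<and> 2 < M t r \<and> 2 < M r s)"

definition coxeter_rels :: "'s set \<Rightarrow> ('s \<Rightarrow> 's \<Rightarrow> enat) \<Rightarrow> ('s gword \<times> 's gword) set" where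
  "coxeter_rels S M = {(pos_word [s, s], []) |s. s \<in> S} \<union>
     {(pos_word (concat (replicate n [s, t])), []) |s t n. s \<in> S \<and> t \<in> S \<and> M s t = enat n}"

definition coxeter_group :: "'s set \<Rightarrow> ('s \<Rightarrow> 's \<Rightarrow> enat) \<Rightarrow> 's gword set monoid" where
  "coxeter_group S M = presented_group S (coxeter_rels S M)"

primrec alternating :: "nat \<Rightarrow> 's \<Rightarrow> 's \<Rightarrow> 's list" where
  "alternating 0 s t = []"
| "alternating (Suc n) s t = s # alternating n t s"

definition artin_rels :: "'s set \<Rightarrow> ('s \<Rightarrow> 's \<Rightarrow> enat) \<Rightarrow> ('s gword \<times> 's gword) set" where
  "artin_rels S M = {(pos_word (alternating n s t), pos_word (alternating n t s)) |s t n.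
     s \<in> S \<and> t \<in> S \<and> s \<noteq> t \<and> M s t = enat n}"

definition artin_group :: "'s set \<Rightarrow> ('s \<Rightarrow> 's \<Rightarrow> enat) \<Rightarrow> 's gword set monoid" where
  "artin_group S M = presented_group S (artin_rels S M)"

definition artin_gen :: "'s set \<Rightarrow> ('s \<Rightarrow> 's \<Rightarrow> enat) \<Rightarrow> 's \<Rightarrow> 's gword set" where
  "artin_gen S M s = pres_class S (artin_rels S M) (pos_word [s])"

text \<open>
  \<open>\<sigma>\<^sub>s \<mapsto> s\<close>: a class of words modulo the Artin relations is sent to the class, modulo the Coxeter
  relations, of any of its members. The union below is over equal sets.
\<close>
definition artin_to_coxeter :: "'s set \<Rightarrow> ('s \<Rightarrow> 's \<Rightarrow> enat) \<Rightarrow> 's gword set \<Rightarrow> 's gword set" where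
  "artin_to_coxeter S M X = (\<Union>w\<in>X. pres_class S (coxeter_rels S M) w)"

definition pure_artin_group :: "'s set \<Rightarrow> ('s \<Rightarrow> 's \<Rightarrow> enat) \<Rightarrow> 's gword set monoid" where
  "pure_artin_group S M = (artin_group S M)
     \<lparr>carrier := kernel (artin_group S M) (coxeter_group S M) (artin_to_coxeter S M)\<rparr>"


lemma alternating_add:
  "alternating (m + n) s t = alternating m s t @ (if even m then alternating n s t else alternating n t s)"
  by (induction m arbitrary: s t) auto

lemma rev_alternating:
  "rev (alternating n t s) = (if even n then alternating n s t else alternating n t s)"
proof (induction n)
  case (Suc n)
  then show ?case
    using alternating_add[of n 1 t s] by simp
qed simp

lemma concat_replicate_alternating:
  "concat (replicate n [s, t]) = alternating n s t @ rev (alternating n t s)"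
proof -
  have "concat (replicate n [s, t]) = alternating (n + n) s t"
    by (induction n) auto
  then show ?thesis
    by (simp only: alternating_add rev_alternating)
qed

lemma set_alternating: "set (alternating n s t) \<subseteq> {s, t}"
  by (induction n arbitrary: s t) auto

lemma coxeter_rels_rev:
  assumes "set w \<subseteq> S"
  shows "pres_eq S (coxeter_rels S M) (pos_word (rev w) @ pos_word w) []"
  using assms
proof (induction w)
  case (Cons s w)
  then have "pres_eq S (coxeter_rels S M) (pos_word [s, s]) []"
    by (intro pres_eq.rel) (auto simp: coxeter_rels_def)
  then have "pres_eq S (coxeter_rels S M)
      (pos_word (rev w) @ pos_word [s, s] @ pos_word w) (pos_word (rev w) @ [] @ pos_word w)"
    using Cons.prems by (intro pres_eq.append pres_eq.refl) auto
  moreover have "pres_eq S (coxeter_rels S M) (pos_word (rev w) @ pos_word w) []"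
    using Cons by simp
  ultimately show ?case
    using pres_eq.trans by fastforce
qed (simp add: pres_eq.refl)

lemma pres_eq_artin_imp_coxeter:
  assumes "pres_eq S (artin_rels S M) u v"
  shows "pres_eq S (coxeter_rels S M) u v"
  using assms
proof (induction rule: pres_eq.induct)
  case (rel u v)
  then obtain s t n where st: "s \<in> S" "t \<in> S" "M s t = enat n"
    and u: "u = pos_word (alternating n s t)" and v: "v = pos_word (alternating n t s)"
    by (auto simp: artin_rels_def)
  define v' where "v' = pos_word (rev (alternating n t s))"
  have sub: "set (alternating n t s) \<subseteq> S"
    using set_alternating[of n t s] st by auto
  then have v': "v' \<in> gwords S"
    by (simp add: v'_def)
  have "pres_eq S (coxeter_rels S M) (u @ v' @ v) (u @ [])"
    using rel coxeter_rels_rev[OF sub, of M]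
    by (intro pres_eq.append pres_eq.refl) (auto simp: v'_def v)
  moreover have "pres_eq S (coxeter_rels S M) (u @ v') []"
  proof (rule pres_eq.rel)
    have "u @ v' = pos_word (concat (replicate n [s, t]))"
      by (simp only: u v'_def concat_replicate_alternating pos_word_simps)
    then show "(u @ v', []) \<in> coxeter_rels S M"
      using st by (auto simp: coxeter_rels_def)
  qed (use rel v' in auto)
  then have "pres_eq S (coxeter_rels S M) ((u @ v') @ v) ([] @ v)"
    using rel by (intro pres_eq.append pres_eq.refl)
  ultimately show ?case
    using pres_eq.sym pres_eq.trans by (metis append.assoc append.left_neutral append.right_neutral)
qed (blast intro: pres_eq.intros)+

lemma artin_to_coxeter_class:
  assumes "w \<in> gwords S"
  shows "artin_to_coxeter S M (pres_class S (artin_rels S M) w) = pres_class S (coxeter_rels S M) w"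
proof -
  have "pres_class S (coxeter_rels S M) v = pres_class S (coxeter_rels S M) w"
    if "v \<in> pres_class S (artin_rels S M) w" for v
    using that assms pres_class_eq_iff[of w S "coxeter_rels S M" v]
      pres_eq_artin_imp_coxeter[of S M w v] by (simp add: pres_class_def[of S "artin_rels S M"])
  moreover have "w \<in> pres_class S (artin_rels S M) w"
    using assms by (simp add: pres_class_def pres_eq.refl)
  ultimately show ?thesis
    unfolding artin_to_coxeter_def by blast
qed

lemma artin_to_coxeter_epi:
  "artin_to_coxeter S M \<in> epi (artin_group S M) (coxeter_group S M)"
proof -
  have c: "carrier (artin_group S M) = pres_class S (artin_rels S M) ` gwords S"
     "carrier (coxeter_group S M) = pres_class S (coxeter_rels S M) ` gwords S"
    by (simp_all add: artin_group_def coxeter_group_def presented_group_def)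
  have "artin_to_coxeter S M (X \<otimes>\<^bsub>artin_group S M\<^esub> Y)
      = artin_to_coxeter S M X \<otimes>\<^bsub>coxeter_group S M\<^esub> artin_to_coxeter S M Y"
    if "X \<in> carrier (artin_group S M)" "Y \<in> carrier (artin_group S M)" for X Y
    using that unfolding c
    by (auto simp: artin_group_def coxeter_group_def mult_pres_class artin_to_coxeter_class)
  then show ?thesis
    unfolding epi_def hom_def c
    by (auto simp: artin_to_coxeter_class image_image)
qed

lemma group_pure_artin_group:
  "group (pure_artin_group S M)"
proof -
  interpret group_hom "artin_group S M" "coxeter_group S M" "artin_to_coxeter S M"
    using artin_to_coxeter_epi group_presented_group
    by (auto simp: epi_def artin_group_def coxeter_group_def group_hom_def group_hom_axioms_def)
  show ?thesis
    unfolding pure_artin_group_def by (rule subgroup.subgroup_is_group[OF subgroup_kernel]) unfold_locales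
qed


section \<open>Roots and depth\<close>

text \<open>
  \<open>U\<close> consists of the \<^typ>\<open>'s \<Rightarrow>\<^sub>0 real\<close> supported in \<open>S\<close>; then \<open>Poly_Mapping.single s c\<close> is \<open>c\<alpha>\<^sub>s\<close>.
\<close>
definition simple_root :: "'s \<Rightarrow> 's \<Rightarrow>\<^sub>0 real" where
  "simple_root s = Poly_Mapping.single s 1"

definition gram :: "('s \<Rightarrow> 's \<Rightarrow> enat) \<Rightarrow> 's \<Rightarrow> 's \<Rightarrow> real" where
  "gram M s t = (case M s t of enat m \<Rightarrow> - 2 * cos (pi / real m) | \<infinity> \<Rightarrow> - 2)"

definition bform :: "'s set \<Rightarrow> ('s \<Rightarrow> 's \<Rightarrow> enat) \<Rightarrow> ('s \<Rightarrow>\<^sub>0 real) \<Rightarrow> ('s \<Rightarrow>\<^sub>0 real) \<Rightarrow> real" where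
  "bform S M u v = (\<Sum>r\<in>S. \<Sum>q\<in>S. Poly_Mapping.lookup u r * Poly_Mapping.lookup v q * gram M r q)"

definition reflection :: "'s set \<Rightarrow> ('s \<Rightarrow> 's \<Rightarrow> enat) \<Rightarrow> 's \<Rightarrow> ('s \<Rightarrow>\<^sub>0 real) \<Rightarrow> 's \<Rightarrow>\<^sub>0 real" where
  "reflection S M s u = u - Poly_Mapping.single s (bform S M (simple_root s) u)"

text \<open>An inverse letter acts as the letter itself because reflections are involutions.\<close>
definition word_action ::
  "'s set \<Rightarrow> ('s \<Rightarrow> 's \<Rightarrow> enat) \<Rightarrow> 's gword \<Rightarrow> ('s \<Rightarrow>\<^sub>0 real) \<Rightarrow> 's \<Rightarrow>\<^sub>0 real" where
  "word_action S M w u = foldr (\<lambda>(s, b). reflection S M s) w u"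

definition coxeter_action ::
  "'s set \<Rightarrow> ('s \<Rightarrow> 's \<Rightarrow> enat) \<Rightarrow> 's gword set \<Rightarrow> ('s \<Rightarrow>\<^sub>0 real) \<Rightarrow> 's \<Rightarrow>\<^sub>0 real" where
  "coxeter_action S M X = word_action S M (SOME w. w \<in> X)"

lemma gram_small:
  assumes "coxeter_matrix S M" "small_matrix S M" "s \<in> S" "t \<in> S"
  shows "gram M s t = (if s = t then 2 else if M s t = 2 then 0 else - 1)"
    and "gram M s t = gram M t s"
proof -
  have *: "gram M s t = (if s = t then 2 else if M s t = 2 then 0 else - 1)" if "s \<in> S" "t \<in> S" for s t
  proof (cases "s = t")
    case True
    then show ?thesis
      using assms that by (simp add: coxeter_matrix_def gram_def one_enat_def)
  next
    case False
    then have "M s t = 2 \<or> M s t = 3"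
      using assms that by (auto simp: small_matrix_def)
    then show ?thesis
      using False cos_60 by (auto simp: gram_def numeral_eq_enat)
  qed
  show "gram M s t = (if s = t then 2 else if M s t = 2 then 0 else - 1)" "gram M s t = gram M t s"
    using *[of s t] *[of t s] assms by (auto simp: coxeter_matrix_def)
qed

lemma word_action_cong:
  assumes S: "finite S" and M: "coxeter_matrix S M" "small_matrix S M"
    and "pres_eq S (coxeter_rels S M) u v"
  shows "word_action S M u = word_action S M v"
proof -
  have bf: "bform S M (simple_root s) w = (\<Sum>q\<in>S. Poly_Mapping.lookup w q * gram M s q)" if "s \<in> S" for s w
  proof -
    have "bform S M (simple_root s) w = (\<Sum>r\<in>S. if r = s then (\<Sum>q\<in>S. Poly_Mapping.lookup w q * gram M s q) else 0)"
      unfolding bform_def simple_root_def by (intro sum.cong) (auto simp: lookup_single)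
    then show ?thesis using S that by simp
  qed
  have bdiff: "bform S M (simple_root s) (w - Poly_Mapping.single t c) = bform S M (simple_root s) w - c * gram M s t"
    if "s \<in> S" "t \<in> S" for s t w c
  proof -
    have "(\<Sum>q\<in>S. (Poly_Mapping.lookup (Poly_Mapping.single t c) q) * gram M s q) = (\<Sum>q\<in>S. if q = t then c * gram M s t else 0)"
      by (intro sum.cong) (auto simp: lookup_single)
    then show ?thesis
      using that S by (simp add: bf lookup_minus left_diff_distrib sum_subtractf)
  qed
  have invol: "reflection S M s (reflection S M s w) = w" if "s \<in> S" for s w
    using that gram_small(1)[OF M, of s s]
    by (simp add: reflection_def bdiff) (simp add: poly_mapping_eq_iff fun_eq_iff lookup_minus lookup_single when_def)
  have app: "word_action S M (u @ v) = word_action S M u \<circ> word_action S M v" for u v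
    by (auto simp: word_action_def)
  have braid: "word_action S M (pos_word (concat (replicate n [s, t]))) w = w"
    if st: "s \<in> S" "t \<in> S" "M s t = enat n" for s t n w
  proof (cases "s = t")
    case True
    then have "n = 1" using M st by (auto simp: coxeter_matrix_def one_enat_def)
    then show ?thesis using True st invol by (simp add: word_action_def)
  next
    case False
    note g = gram_small[OF M st(1,2)] gram_small(1)[OF M st(1) st(1)] gram_small(1)[OF M st(2) st(2)]
    have "n = 2 \<or> n = 3"
      using M st False by (fastforce simp: small_matrix_def numeral_eq_enat)
    then show ?thesis
    proof
      assume n: "n = 2"
      have "gram M s t = 0" "gram M t s = 0"
        using g False st n by (auto simp: numeral_eq_enat)
      then show ?thesis
        using st n False g by (simp add: numeral_eq_Suc word_action_def reflection_def bdiff)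
          (simp add: poly_mapping_eq_iff fun_eq_iff lookup_minus lookup_single when_def)
    next
      assume n: "n = 3"
      have "gram M s t = -1" "gram M t s = -1"
        using g False st n by (auto simp: numeral_eq_enat)
      then show ?thesis
        using st n False g by (simp add: numeral_eq_Suc word_action_def reflection_def bdiff)
          (simp add: poly_mapping_eq_iff fun_eq_iff lookup_minus lookup_single when_def)
    qed
  qed
  show ?thesis
    using assms(4)
  proof (induction rule: pres_eq.induct)
    case (cancel s b)
    then show ?case by (simp add: word_action_def fun_eq_iff invol)
  next
    case (rel u v)
    then show ?case
      using braid invol unfolding coxeter_rels_def
      by (auto simp: fun_eq_iff) (simp_all add: word_action_def)
  qed (auto simp: app)
qed

lemma coxeter_action_class:
  assumes "finite S" "coxeter_matrix S M" "small_matrix S M" "w \<in> gwords S"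
  shows "coxeter_action S M (pres_class S (coxeter_rels S M) w) = word_action S M w"
proof -
  have "(SOME v. v \<in> pres_class S (coxeter_rels S M) w) \<in> pres_class S (coxeter_rels S M) w"
    by (rule someI[of _ w]) (simp add: pres_class_def pres_eq.refl assms(4))
  then show ?thesis
    unfolding coxeter_action_def pres_class_def mem_Collect_eq
    using word_action_cong[OF assms(1-3)] by metis
qed

definition roots :: "'s set \<Rightarrow> ('s \<Rightarrow> 's \<Rightarrow> enat) \<Rightarrow> ('s \<Rightarrow>\<^sub>0 real) set" where
  "roots S M = {coxeter_action S M w (simple_root s) |w s. w \<in> carrier (coxeter_group S M) \<and> s \<in> S}"

definition pos_roots :: "'s set \<Rightarrow> ('s \<Rightarrow> 's \<Rightarrow> enat) \<Rightarrow> ('s \<Rightarrow>\<^sub>0 real) set" where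
  "pos_roots S M = {\<beta>\<in>roots S M. \<forall>s\<in>S. 0 \<le> Poly_Mapping.lookup \<beta> s}"

definition neg_roots :: "'s set \<Rightarrow> ('s \<Rightarrow> 's \<Rightarrow> enat) \<Rightarrow> ('s \<Rightarrow>\<^sub>0 real) set" where
  "neg_roots S M = uminus ` pos_roots S M"

definition coxeter_length :: "'s set \<Rightarrow> ('s \<Rightarrow> 's \<Rightarrow> enat) \<Rightarrow> 's gword set \<Rightarrow> nat" where
  "coxeter_length S M X =
     (LEAST n. \<exists>w\<in>lists S. length w = n \<and> X = pres_class S (coxeter_rels S M) (pos_word w))"

definition root_depth :: "'s set \<Rightarrow> ('s \<Rightarrow> 's \<Rightarrow> enat) \<Rightarrow> ('s \<Rightarrow>\<^sub>0 real) \<Rightarrow> nat" where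
  "root_depth S M \<beta> = (LEAST n. \<exists>w\<in>carrier (coxeter_group S M).
     coxeter_length S M w = n \<and> coxeter_action S M w \<beta> \<in> neg_roots S M)"


section \<open>The polynomials \<open>T(s,\<beta>)\<close>\<close>

abbreviation poly_y :: "rat poly" where
  "poly_y \<equiv> [:0, 1:]"

text \<open>
  Every root to which a recursive call is applied has strictly smaller depth than \<open>\<beta>\<close>, so the
  induction on the depth is completed after \<open>root_depth S M \<beta>\<close> rounds; the counter \<open>n\<close> plays no other
  role. Only small matrices are intended: there \<open>gram M s t\<close> is \<open>0\<close> or \<open>-1\<close> for \<open>s \<noteq> t\<close>, and \<open>s = t\<close>
  can occur only in the first case, since \<open>b > 0\<close>.
\<close>
primrec paris_T_upto ::
  "'s set \<Rightarrow> ('s \<Rightarrow> 's \<Rightarrow> enat) \<Rightarrow> nat \<Rightarrow> 's \<Rightarrow> ('s \<Rightarrow>\<^sub>0 real) \<Rightarrow> rat poly" where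
  "paris_T_upto S M 0 s \<beta> = 0"
| "paris_T_upto S M (Suc n) s \<beta> =
    (if root_depth S M \<beta> = 1 then (if \<beta> = simple_root s then poly_y ^ 2 else 0)
     else
       let T = paris_T_upto S M n;
           d = root_depth S M \<beta>;
           t = (SOME t. t \<in> S \<and> reflection S M t \<beta> \<in> pos_roots S M \<and>
                        root_depth S M (reflection S M t \<beta>) = d - 1);
           b = bform S M (simple_root t) \<beta>;
           c = bform S M (simple_root s) \<beta>;
           a = - c
       in
         if c > 0 then poly_y ^ d * (poly_y - 1)
         else if c = 0 then
           if gram M s t = 0 then poly_y * T s (\<beta> - Poly_Mapping.single t b)
           else (poly_y - 1) * T s (\<beta> - Poly_Mapping.single t b)
                + poly_y * T t (\<beta> - Poly_Mapping.single s b - Poly_Mapping.single t b)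
         else
           if gram M s t = 0 then poly_y * T s (\<beta> - Poly_Mapping.single t b)
           else if b > a then (poly_y - 1) * T s (\<beta> - Poly_Mapping.single t b)
                + poly_y * T t (\<beta> - Poly_Mapping.single s (b - a) - Poly_Mapping.single t b)
           else if b = a then T t (\<beta> - Poly_Mapping.single t b)
                + (poly_y - 1) * T s (\<beta> - Poly_Mapping.single t b)
           else poly_y * T s (\<beta> - Poly_Mapping.single t b) + T t (\<beta> - Poly_Mapping.single t b)
                + poly_y ^ (d - 1) * (1 - poly_y))"

definition paris_T ::
  "'s set \<Rightarrow> ('s \<Rightarrow> 's \<Rightarrow> enat) \<Rightarrow> 's \<Rightarrow> ('s \<Rightarrow>\<^sub>0 real) \<Rightarrow> rat poly" where
  "paris_T S M s \<beta> = paris_T_upto S M (root_depth S M \<beta>) s \<beta>"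


section \<open>The Paris representation\<close>

text \<open>
  \<open>\<rat>[x,y,x\<inverse>,y\<inverse>]\<close> as the group ring of \<open>\<int>\<^sup>2\<close>; multiplication of \<^type>\<open>poly_mapping\<close> is convolution.
\<close>
type_synonym laurent2 = "(int \<times> int) \<Rightarrow>\<^sub>0 rat"

definition lx :: laurent2 where "lx = Poly_Mapping.single (1, 0) 1"
definition ly :: laurent2 where "ly = Poly_Mapping.single (0, 1) 1"

definition poly_at_ly :: "rat poly \<Rightarrow> laurent2" where
  "poly_at_ly p = poly (map_poly (Poly_Mapping.single 0) p) ly"

definition paris_V :: "'s set \<Rightarrow> ('s \<Rightarrow> 's \<Rightarrow> enat) \<Rightarrow> (('s \<Rightarrow>\<^sub>0 real) \<Rightarrow>\<^sub>0 laurent2) set" where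
  "paris_V S M = {v. Poly_Mapping.keys v \<subseteq> pos_roots S M}"

definition lscale :: "laurent2 \<Rightarrow> ('b \<Rightarrow>\<^sub>0 laurent2) \<Rightarrow> 'b \<Rightarrow>\<^sub>0 laurent2" where
  "lscale c v = Poly_Mapping.map ((*) c) v"

definition ebasis :: "'b \<Rightarrow> 'b \<Rightarrow>\<^sub>0 laurent2" where
  "ebasis \<beta> = Poly_Mapping.single \<beta> 1"

definition lin_on :: "('b \<Rightarrow>\<^sub>0 laurent2) set \<Rightarrow> (('b \<Rightarrow>\<^sub>0 laurent2) \<Rightarrow> ('b \<Rightarrow>\<^sub>0 laurent2)) \<Rightarrow> bool" where
  "lin_on V f \<longleftrightarrow> (\<forall>u\<in>V. \<forall>v\<in>V. f (u + v) = f u + f v) \<and> (\<forall>c. \<forall>v\<in>V. f (lscale c v) = lscale c (f v))"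

definition GL_group :: "('b \<Rightarrow>\<^sub>0 laurent2) set \<Rightarrow> (('b \<Rightarrow>\<^sub>0 laurent2) \<Rightarrow> ('b \<Rightarrow>\<^sub>0 laurent2)) monoid" where
  "GL_group V = (BijGroup V)\<lparr>carrier := {f\<in>Bij V. lin_on V f}\<rparr>"

definition paris_phi_basis ::
  "'s set \<Rightarrow> ('s \<Rightarrow> 's \<Rightarrow> enat) \<Rightarrow> 's \<Rightarrow> ('s \<Rightarrow>\<^sub>0 real) \<Rightarrow> ('s \<Rightarrow>\<^sub>0 real) \<Rightarrow>\<^sub>0 laurent2" where
  "paris_phi_basis S M s \<beta> =
    (let c = bform S M (simple_root s) \<beta>; a = \<bar>c\<bar> in
       if \<beta> = simple_root s then 0
       else if c = 0 then ebasis \<beta>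
       else if c > 0 then lscale ly (ebasis (\<beta> - Poly_Mapping.single s a))
       else lscale (1 - ly) (ebasis \<beta>) + ebasis (\<beta> + Poly_Mapping.single s a))"

definition paris_psi_basis ::
  "'s set \<Rightarrow> ('s \<Rightarrow> 's \<Rightarrow> enat) \<Rightarrow> 's \<Rightarrow> ('s \<Rightarrow>\<^sub>0 real) \<Rightarrow> ('s \<Rightarrow>\<^sub>0 real) \<Rightarrow>\<^sub>0 laurent2" where
  "paris_psi_basis S M s \<beta> = paris_phi_basis S M s \<beta>
     + lscale (lx * poly_at_ly (paris_T S M s \<beta>)) (ebasis (simple_root s))"

definition paris_psi ::
  "'s set \<Rightarrow> ('s \<Rightarrow> 's \<Rightarrow> enat) \<Rightarrow> 's \<Rightarrow>
   (('s \<Rightarrow>\<^sub>0 real) \<Rightarrow>\<^sub>0 laurent2) \<Rightarrow> ('s \<Rightarrow>\<^sub>0 real) \<Rightarrow>\<^sub>0 laurent2" where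
  "paris_psi S M s = (\<lambda>v\<in>paris_V S M.
     \<Sum>\<beta>\<in>Poly_Mapping.keys v. lscale (Poly_Mapping.lookup v \<beta>) (paris_psi_basis S M s \<beta>))"

lemma lookup_lscale [simp]: "Poly_Mapping.lookup (lscale c v) k = c * Poly_Mapping.lookup v k"
  unfolding lscale_def by (simp add: map.rep_eq when_def)

lemma paris_psi_ebasis:
  assumes "\<beta> \<in> pos_roots S M"
  shows "paris_psi S M s (ebasis \<beta>) = paris_psi_basis S M s \<beta>"
proof -
  have "lscale 1 v = v" for v :: "('s \<Rightarrow>\<^sub>0 real) \<Rightarrow>\<^sub>0 laurent2"
    by (simp add: poly_mapping_eq_iff fun_eq_iff)
  then show ?thesis
    using assms by (simp add: paris_psi_def paris_V_def ebasis_def)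
qed

lemma group_GL_group: "group (GL_group (paris_V S M))"
proof -
  let ?V = "paris_V S M"
  have add: "u + v \<in> ?V" if "u \<in> ?V" "v \<in> ?V" for u v
    using that keys_add[of u v] by (auto simp: paris_V_def)
  have scale: "lscale c v \<in> ?V" if "v \<in> ?V" for c v
    using that mult_not_zero unfolding paris_V_def
    by (simp add: subset_iff in_keys_iff) blast
  interpret group "BijGroup ?V" by (rule group_BijGroup)
  have "subgroup {f \<in> Bij ?V. lin_on ?V f} (BijGroup ?V)"
  proof (rule subgroupI)
    show "{f \<in> Bij ?V. lin_on ?V f} \<noteq> {}"
      using id_Bij[of ?V] add scale by (fastforce simp: lin_on_def)
  next
    fix f assume f: "f \<in> {f \<in> Bij ?V. lin_on ?V f}"
    then have bij: "bij_betw f ?V ?V" and inv: "inv\<^bsub>BijGroup ?V\<^esub> f = restrict (inv_into ?V f) ?V"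
      by (auto simp: Bij_def inv_BijGroup)
    have g: "inv_into ?V f v \<in> ?V" "f (inv_into ?V f v) = v" if "v \<in> ?V" for v
      using bij that by (auto simp: bij_betw_def inv_into_into f_inv_into_f)
    have g': "inv_into ?V f (f v) = v" if "v \<in> ?V" for v
      using bij that by (simp add: bij_betw_def)
    have "inv_into ?V f (u + v) = inv_into ?V f u + inv_into ?V f v" if "u \<in> ?V" "v \<in> ?V" for u v
      using g'[OF add[OF g(1)[OF that(1)] g(1)[OF that(2)]]] f g that by (simp add: lin_on_def)
    moreover have "inv_into ?V f (lscale c v) = lscale c (inv_into ?V f v)" if "v \<in> ?V" for c v
      using g'[OF scale[OF g(1)[OF that]], of c] f g that by (simp add: lin_on_def)
    ultimately have "lin_on ?V (restrict (inv_into ?V f) ?V)"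
      by (simp add: lin_on_def add scale)
    then show "inv\<^bsub>BijGroup ?V\<^esub> f \<in> {f \<in> Bij ?V. lin_on ?V f}"
      using restrict_inv_into_Bij[of f ?V] f by (simp add: inv)
  next
    fix f g assume "f \<in> {f \<in> Bij ?V. lin_on ?V f}" "g \<in> {f \<in> Bij ?V. lin_on ?V f}"
    then show "f \<otimes>\<^bsub>BijGroup ?V\<^esub> g \<in> {f \<in> Bij ?V. lin_on ?V f}"
      using Bij_imp_funcset[of g ?V] compose_Bij[of f ?V g] add scale
      by (auto simp: BijGroup_def lin_on_def compose_def Pi_def)
  qed (auto simp: BijGroup_def)
  then show ?thesis
    unfolding GL_group_def by (rule subgroup.subgroup_is_group) (rule group_BijGroup)
qed

text \<open>
  The values on the generators determine \<open>\<Psi>\<close> on the carrier of the Artin group. That such a \<open>\<Psi>\<close>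
  exists for small triangle-free \<open>M\<close> is a theorem of Paris.
\<close>
definition paris_representation ::
  "'s set \<Rightarrow> ('s \<Rightarrow> 's \<Rightarrow> enat) \<Rightarrow>
   ('s gword set \<Rightarrow> (('s \<Rightarrow>\<^sub>0 real) \<Rightarrow>\<^sub>0 laurent2) \<Rightarrow> ('s \<Rightarrow>\<^sub>0 real) \<Rightarrow>\<^sub>0 laurent2) \<Rightarrow> bool" where
  "paris_representation S M \<Psi> \<longleftrightarrow> \<Psi> \<in> hom (artin_group S M) (GL_group (paris_V S M)) \<and>
     (\<forall>s\<in>S. \<Psi> (artin_gen S M s) = paris_psi S M s)"

end

theory Submission
  imports
    Defs
    "HOL-Computational_Algebra.Formal_Power_Series"
begin

text \<open>
  Put \<open>x = exp h\<close> and \<open>y = exp (\<surd>2 h)\<close>. Since \<open>1\<close> and \<open>\<surd>2\<close> are linearly independent over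
  \<open>\<rat>\<close>, this embeds \<open>\<rat>[x,y,x\<inverse>,y\<inverse>]\<close> into \<open>\<real>[[h]]\<close>, and the order in \<open>h\<close> gives a separated filtration
  \<open>F\<^sub>n\<close> of \<open>V\<close> with torsion-free quotients. Modulo \<open>F\<^sub>1\<close> one has \<open>x = y = 1\<close>, where \<open>T(s,\<beta>)\<close> vanishes unless
  \<open>\<beta> = \<alpha>\<^sub>s\<close>, so that \<open>\<psi>\<^sub>s\<close> becomes the permutation of the positive roots, seen as roots up to sign, induced
  by \<open>s\<close>. Hence the pure Artin group acts trivially on all \<open>F\<^sub>n / F\<^sub>n\<^sub>+\<^sub>1\<close>. A group acting faithfully and unipotently
  in this sense is residually torsion-free nilpotent: the elements \<open>g\<close> with \<open>(g - 1)F\<^sub>n \<subseteq> F\<^sub>n\<^sub>+\<^sub>k\<close> for all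
  \<open>n\<close> form a central series with torsion-free quotients and trivial intersection.
\<close>

section \<open>Unipotent actions on filtered groups\<close>

text \<open>The groups \<open>Q\<close> are the quotients \<open>G Mod N n\<close>: an element
  outside \<open>N n\<close> survives in that quotient. The central series makes it nilpotent, and
  isolation of \<open>N (Suc k)\<close> in \<open>N k\<close> makes it torsion-free.\<close>

lemma residually_torsion_free_nilpotentI:
  fixes G (structure) and N :: "nat \<Rightarrow> 'a set"
  assumes G: "group G"
    and top: "N 0 = carrier G"
    and sub: "\<And>k. subgroup (N k) G"
    and decreasing: "\<And>k. N (Suc k) \<subseteq> N k"
    and central: "\<And>k h g. h \<in> N k \<Longrightarrow> g \<in> carrier G \<Longrightarrow> h \<otimes> g \<otimes> inv h \<otimes> inv g \<in> N (Suc k)"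
    and isolated: "\<And>k g m. g \<in> N k \<Longrightarrow> 0 < m \<Longrightarrow> g [^] (m::nat) \<in> N (Suc k) \<Longrightarrow> g \<in> N (Suc k)"
    and separated: "\<And>g. (\<And>k. g \<in> N k) \<Longrightarrow> g = \<one>"
  shows "residually_torsion_free_nilpotent G"
proof -
  interpret group G by (rule G)
  have carr: "g \<in> carrier G" if "g \<in> N k" for g k
    using sub that by (rule subgroup.mem_carrier)
  \<comment> \<open>Normality follows from centrality: \<open>x h x^-1 = h [h^-1, x]\<close>, where
    \<open>[a, b] = a b a^-1 b^-1\<close>, and the commutator lies in
    \<open>N (Suc k) \<subseteq> N k\<close>.\<close>
  have normal: "N k \<lhd> G" for k
    unfolding normal_inv_iff
  proof (intro conjI ballI sub)
    fix x h assume x: "x \<in> carrier G" and h: "h \<in> N k"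
    have "inv h \<otimes> x \<otimes> inv (inv h) \<otimes> inv x \<in> N k"
      using central[of "inv h" k x] subgroup.m_inv_closed[OF sub h] x decreasing by blast
    then have "h \<otimes> (inv h \<otimes> x \<otimes> inv (inv h) \<otimes> inv x) \<in> N k"
      by (rule subgroup.m_closed[OF sub h])
    also have "h \<otimes> (inv h \<otimes> x \<otimes> inv (inv h) \<otimes> inv x) = x \<otimes> h \<otimes> inv x"
      using x carr[OF h] by (simp add: m_assoc[symmetric])
    finally show "x \<otimes> h \<otimes> inv x \<in> N k" .
  qed
  have anti: "N n \<subseteq> N k" if "k \<le> n" for k n
    using decreasing that by (rule lift_Suc_antimono_le[of N])
  show ?thesis
    unfolding residually_torsion_free_nilpotent_def
  proof (intro conjI ballI G)
    fix g assume "g \<in> carrier G - {\<one>}"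
    then have g1: "g \<in> carrier G" "g \<noteq> \<one>"
      by simp_all
    then obtain n where n: "g \<notin> N n"
      using separated[of g] by blast
    interpret N: normal "N n" G by (rule normal)
    let ?Q = "G Mod N n" and ?\<pi> = "\<lambda>x. N n #> x"
    interpret Q: group ?Q by (rule N.factorgroup_is_group)
    have hom: "group_hom G ?Q ?\<pi>"
      by (rule group_hom.intro[OF G N.factorgroup_is_group]) (simp add: group_hom_axioms_def N.r_coset_hom_Mod)
    interpret \<pi>: group_hom G ?Q ?\<pi> by (rule hom)
    have one_iff: "?\<pi> x = \<one>\<^bsub>?Q\<^esub> \<longleftrightarrow> x \<in> N n" if "x \<in> carrier G" for x
      unfolding one_FactGroup using coset_join1[OF _ that sub] coset_join2[OF that sub] by blast
    have tf: "torsion_free_group ?Q"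
      unfolding torsion_free_group_def
    proof (intro conjI ballI allI impI Q.group_axioms)
      fix X and m :: nat assume "X \<in> carrier ?Q" and m: "0 < m \<and> X [^]\<^bsub>?Q\<^esub> m = \<one>\<^bsub>?Q\<^esub>"
      then obtain x where x: "x \<in> carrier G" "X = ?\<pi> x"
        by (auto simp: carrier_FactGroup)
      then have xm: "x [^] m \<in> N n"
        using m one_iff[of "x [^] m"] \<pi>.hom_nat_pow by simp
      \<comment> \<open>Climb from \<open>N 0 = carrier G\<close>: for \<open>k < n\<close> the
        power \<open>x [^] m\<close> lies in \<open>N n \<subseteq> N (Suc k)\<close>, so isolation
        lifts \<open>x\<close> from \<open>N k\<close> to \<open>N (Suc k)\<close>.\<close>
      have "x \<in> N k" if "k \<le> n" for k
        using that
      proof (induction k)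
        case (Suc k)
        then show ?case
          using isolated[of x k m] m xm anti[of "Suc k" n] by auto
      qed (use x top in simp)
      then show "X = \<one>\<^bsub>?Q\<^esub>"
        using one_iff x by simp
    qed
    \<comment> \<open>At \<open>k = n\<close> the image on the right is trivial, so the lower
      central series of the quotient has reached the identity there.\<close>
    have lower: "lower_central ?Q k \<subseteq> ?\<pi> ` N k" for k
    proof (induction k)
      case 0
      then show ?case by (simp add: top carrier_FactGroup)
    next
      case (Suc k)
      have sub': "subgroup (?\<pi> ` N (Suc k)) ?Q"
        by (rule \<pi>.subgroup_img_is_subgroup[OF sub])
      show ?case
        unfolding lower_central.simps
      proof (rule Q.generate_subgroup_incl[OF _ sub'], clarify)
        fix X Y assume "X \<in> lower_central ?Q k" "Y \<in> carrier ?Q"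
        then obtain h x where hx: "h \<in> N k" "X = ?\<pi> h" "x \<in> carrier G" "Y = ?\<pi> x"
          using Suc by (auto simp: carrier_FactGroup)
        then have "X \<otimes>\<^bsub>?Q\<^esub> Y \<otimes>\<^bsub>?Q\<^esub> inv\<^bsub>?Q\<^esub> X \<otimes>\<^bsub>?Q\<^esub> inv\<^bsub>?Q\<^esub> Y = ?\<pi> (h \<otimes> x \<otimes> inv h \<otimes> inv x)"
          using carr[of h k] by (simp add: \<pi>.hom_mult \<pi>.hom_inv del: mult_FactGroup)
        then show "X \<otimes>\<^bsub>?Q\<^esub> Y \<otimes>\<^bsub>?Q\<^esub> inv\<^bsub>?Q\<^esub> X \<otimes>\<^bsub>?Q\<^esub> inv\<^bsub>?Q\<^esub> Y \<in> ?\<pi> ` N (Suc k)"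
          using central[of h k x] hx by blast
      qed
    qed
    have "lower_central ?Q n \<subseteq> {\<one>\<^bsub>?Q\<^esub>}"
      using lower[of n] one_iff carr by blast
    moreover have "\<one>\<^bsub>?Q\<^esub> \<in> lower_central ?Q n"
      using Q.one_closed by (cases n) (auto simp del: one_FactGroup intro: generate.one)
    ultimately have "nilpotent_group ?Q"
      unfolding nilpotent_group_def using Q.group_axioms by blast
    moreover have "?\<pi> \<in> epi G ?Q"
      unfolding epi_def by (simp add: \<pi>.homh carrier_FactGroup del: one_FactGroup)
    ultimately show "\<exists>(Q :: 'a set monoid) \<pi>.
        torsion_free_group Q \<and> nilpotent_group Q \<and> \<pi> \<in> epi G Q \<and> \<pi> g \<noteq> \<one>\<^bsub>Q\<^esub>"
      using tf one_iff[OF g1(1)] n by blast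
  qed
qed

text \<open>\<open>F 0\<close> is the module acted upon. The sum in \<open>isolated\<close> is the
  multiple \<open>m v\<close>, written with addition alone, so that \<open>isolated\<close> says
  that \<open>F 0 / F n\<close> is torsion-free.\<close>

locale unipotent_action = group G for G :: "('a, 'b) monoid_scheme" (structure) +
  fixes F :: "nat \<Rightarrow> 'v::ab_group_add set" and act :: "'a \<Rightarrow> 'v \<Rightarrow> 'v"
  assumes zero_mem: "0 \<in> F n"
    and diff_mem: "u \<in> F n \<Longrightarrow> v \<in> F n \<Longrightarrow> u - v \<in> F n"
    and decreasing: "F (Suc n) \<subseteq> F n"
    and separated: "(\<And>n. v \<in> F n) \<Longrightarrow> v = 0"
    and isolated: "v \<in> F 0 \<Longrightarrow> 0 < m \<Longrightarrow> (\<Sum>i<m::nat. v) \<in> F n \<Longrightarrow> v \<in> F n"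
    and act_one: "v \<in> F 0 \<Longrightarrow> act \<one> v = v"
    and act_mult: "g \<in> carrier G \<Longrightarrow> h \<in> carrier G \<Longrightarrow> v \<in> F 0 \<Longrightarrow> act (g \<otimes> h) v = act g (act h v)"
    and act_diff: "g \<in> carrier G \<Longrightarrow> u \<in> F 0 \<Longrightarrow> v \<in> F 0 \<Longrightarrow> act g (u - v) = act g u - act g v"
    and unipotent: "g \<in> carrier G \<Longrightarrow> v \<in> F n \<Longrightarrow> act g v - v \<in> F (Suc n)"
    and faithful: "g \<in> carrier G \<Longrightarrow> (\<And>v. v \<in> F 0 \<Longrightarrow> act g v = v) \<Longrightarrow> g = \<one>"
begin

text \<open>The index is shifted by one: for \<open>g\<close> in \<open>level k\<close> the operator
  \<open>g - 1\<close> raises the filtration degree by \<open>k + 1\<close>, so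
  \<open>level 0\<close> is the whole group by \<open>unipotent\<close>.\<close>

definition level :: "nat \<Rightarrow> 'a set" where
  "level k = {g \<in> carrier G. \<forall>n. \<forall>v\<in>F n. act g v - v \<in> F (n + Suc k)}"

lemma antimono: "m \<le> n \<Longrightarrow> F n \<subseteq> F m"
  using decreasing by (rule lift_Suc_antimono_le[of F])

lemma mem_0: "v \<in> F n \<Longrightarrow> v \<in> F 0"
  using antimono[of 0 n] by auto

lemma add_mem: "u \<in> F n \<Longrightarrow> v \<in> F n \<Longrightarrow> u + v \<in> F n"
  using diff_mem[of u n "0 - v"] diff_mem[OF zero_mem, of v n] by simp

lemma act_mem:
  assumes "g \<in> carrier G" "v \<in> F n"
  shows "act g v \<in> F n"
  using add_mem[of "act g v - v" n v] unipotent[OF assms] assms(2) decreasing by auto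

lemma subgroup_level: "subgroup (level k) G"
proof (rule subgroupI)
  show "level k \<noteq> {}"
    using act_one mem_0 zero_mem by (auto simp: level_def intro!: exI[of _ \<one>])
next
  fix g assume g: "g \<in> level k"
  show "inv g \<in> level k"
    unfolding level_def
  proof (intro CollectI conjI allI ballI)
    fix n v assume v: "v \<in> F n"
    have gc: "g \<in> carrier G" using g by (simp add: level_def)
    define w where "w = act (inv g) v"
    have w: "w \<in> F n" unfolding w_def using v gc by (simp add: act_mem)
    have "act g w = v"
      using act_mult[of g "inv g" v] gc v mem_0 act_one by (simp add: w_def)
    then have "0 - (w - v) \<in> F (n + Suc k)"
      using g w by (auto simp: level_def)
    then show "act (inv g) v - v \<in> F (n + Suc k)"
      using diff_mem[OF zero_mem, of "0 - (w - v)"] by (simp add: w_def)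
  qed (use g in \<open>simp add: level_def\<close>)
next
  fix g h assume g: "g \<in> level k" and h: "h \<in> level k"
  then have c: "g \<in> carrier G" "h \<in> carrier G" by (simp_all add: level_def)
  have "act (g \<otimes> h) v - v \<in> F (n + Suc k)" if v: "v \<in> F n" for n v
  proof -
    have "(act g (act h v) - act h v) + (act h v - v) \<in> F (n + Suc k)"
      using g h v act_mem[OF c(2) v] by (intro add_mem) (auto simp: level_def)
    then show ?thesis using c v mem_0 by (simp add: act_mult)
  qed
  then show "g \<otimes> h \<in> level k" using c by (simp add: level_def)
qed (simp add: level_def)

text \<open>With \<open>w = (g h)^-1 v\<close> one has \<open>[h, g] v - v = h g w - g h w = (h -
  1)(g - 1) w - (g - 1)(h - 1) w\<close>. In both products \<open>h - 1\<close> raises the degree by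
  \<open>k + 1\<close> and \<open>g - 1\<close> by one more.\<close>

lemma level_commutator:
  assumes h: "h \<in> level k" and g: "g \<in> carrier G"
  shows "h \<otimes> g \<otimes> inv h \<otimes> inv g \<in> level (Suc k)"
proof -
  have hc: "h \<in> carrier G" using h by (simp add: level_def)
  let ?c = "h \<otimes> g \<otimes> inv h \<otimes> inv g"
  have "act ?c v - v \<in> F (n + Suc (Suc k))" if v: "v \<in> F n" for n v
  proof -
    define w where "w = act (inv (g \<otimes> h)) v"
    have w: "w \<in> F n" unfolding w_def using v g hc by (simp add: act_mem)
    note w0 = mem_0[OF w]
    have ghw: "act g (act h w) = v"
      using act_mult[of "g \<otimes> h" "inv (g \<otimes> h)" v] act_mult[of g h w] g hc v mem_0 act_one w0
      by (simp add: w_def)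
    have cv: "act ?c v = act h (act g w)"
    proof -
      have "?c \<otimes> (g \<otimes> h) = h \<otimes> g"
        using g hc by (simp add: m_assoc inv_solve_left')
      then show ?thesis
        using act_mult[of ?c "g \<otimes> h" w] act_mult[of g h w] act_mult[of h g w] g hc w0 ghw by simp
    qed
    have "act h (act g w - w) - (act g w - w) \<in> F (Suc n + Suc k)"
      using h unipotent[OF g w] unfolding level_def by blast
    moreover have "act g (act h w - w) - (act h w - w) \<in> F (Suc (n + Suc k))"
      using unipotent[OF g, of "act h w - w"] h w unfolding level_def by blast
    ultimately have "(act h (act g w - w) - (act g w - w)) - (act g (act h w - w) - (act h w - w))
        \<in> F (n + Suc (Suc k))"
      unfolding add_Suc add_Suc_right by (rule diff_mem)
    moreover have "(act h (act g w - w) - (act g w - w)) - (act g (act h w - w) - (act h w - w))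
        = act h (act g w) - act g (act h w)"
      using w0 g hc by (simp add: act_diff act_mem)
    ultimately show ?thesis by (simp add: cv ghw)
  qed
  then show ?thesis using g hc by (simp add: level_def)
qed

text \<open>Modulo \<open>F (n + k + 2)\<close>, \<open>g^j v - v\<close> equals
  \<open>j (g v - v)\<close>: passing from \<open>j\<close> to \<open>j + 1\<close> makes the error
  \<open>(g - 1)(g^j - 1) v\<close>, which gains \<open>k + 1\<close> from \<open>g^j\<close> in
  \<open>level k\<close> and one more from \<open>g - 1\<close>. For \<open>j = m\<close> this puts
  \<open>m (g v - v)\<close> into \<open>F (n + k + 2)\<close>, and \<open>isolated\<close> removes
  the factor \<open>m\<close>.\<close>

lemma level_isolated:
  assumes g: "g \<in> level k" and m: "0 < m" and gm: "g [^] (m::nat) \<in> level (Suc k)"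
  shows "g \<in> level (Suc k)"
proof -
  have gc: "g \<in> carrier G" using g by (simp add: level_def)
  have "act g v - v \<in> F (n + Suc (Suc k))" if v: "v \<in> F n" for n v
  proof -
    note v0 = mem_0[OF v]
    have "(act (g [^] j) v - v) - (\<Sum>i<j. act g v - v) \<in> F (n + Suc (Suc k))" for j :: nat
    proof (induction j)
      case 0
      then show ?case using v0 act_one zero_mem by simp
    next
      case (Suc j)
      have "g [^] j \<in> level k"
        by (induction j) (use subgroup_level g in \<open>auto intro: subgroup.one_closed subgroup.m_closed\<close>)
      then have "act (g [^] j) v - v \<in> F (n + Suc k)"
        using v by (simp add: level_def)
      then have "act g (act (g [^] j) v - v) - (act (g [^] j) v - v) \<in> F (n + Suc (Suc k))"
        using unipotent[OF gc, of _ "n + Suc k"] by simp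
      also have "act g (act (g [^] j) v - v) = act (g [^] Suc j) v - act g v"
        using act_diff[OF gc, of "act (g [^] j) v" v] act_mem[of "g [^] j" v 0] gc v0
          act_mult[of g "g [^] j" v] nat_pow_Suc2[OF gc, of j] by simp
      finally have "act (g [^] Suc j) v - act g v - (act (g [^] j) v - v)
          + ((act (g [^] j) v - v) - (\<Sum>i<j. act g v - v)) \<in> F (n + Suc (Suc k))"
        by (rule add_mem) (rule Suc)
      then show ?case by (simp add: algebra_simps del: nat_pow_Suc)
    qed
    moreover have "act (g [^] m) v - v \<in> F (n + Suc (Suc k))"
      using gm v by (simp add: level_def)
    ultimately have "(act (g [^] m) v - v) - ((act (g [^] m) v - v) - (\<Sum>i<m. act g v - v))
        \<in> F (n + Suc (Suc k))"
      by (rule diff_mem[rotated])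
    then have "(\<Sum>i<m. act g v - v) \<in> F (n + Suc (Suc k))"
      by simp
    then show ?thesis
      using isolated[OF _ m] mem_0[OF unipotent[OF gc v]] by blast
  qed
  then show ?thesis using gc by (simp add: level_def)
qed

text \<open>The levels are the required central series. An element of all levels moves each vector
  of \<open>F 0\<close> by something in every \<open>F n\<close>, so it fixes the vector by
  \<open>separated\<close> and is trivial by \<open>faithful\<close>.\<close>

theorem residually_torsion_free_nilpotent: "residually_torsion_free_nilpotent G"
proof (rule residually_torsion_free_nilpotentI[where N = level])
  show "level 0 = carrier G"
    using unipotent by (auto simp: level_def)
  show "level (Suc k) \<subseteq> level k" for k
    using decreasing by (fastforce simp: level_def)
next
  fix g assume g: "\<And>k. g \<in> level k"
  show "g = \<one>"
  proof (rule faithful)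
    fix v assume v: "v \<in> F 0"
    have "act g v - v \<in> F n" for n
      using g[of n] v antimono[of n "0 + Suc n"] unfolding level_def
      by (simp only: mem_Collect_eq) (metis add_0 in_mono le_SucI order_refl)
    then show "act g v = v" using separated by fastforce
  qed (use g[of 0] in \<open>simp add: level_def\<close>)
qed (simp_all add: group_axioms subgroup_level level_commutator level_isolated del: nat_pow_Suc)

end


section \<open>Laurent polynomials as power series\<close>

text \<open>The monomial \<open>x^i y^j\<close> becomes \<open>exp (c h)\<close> with
  \<open>c = exponent (i, j)\<close>.\<close>

definition exponent :: "int \<times> int \<Rightarrow> real" where
  "exponent k = of_int (fst k) + sqrt 2 * of_int (snd k)"

definition expand :: "laurent2 \<Rightarrow> real fps" where
  "expand p = (\<Sum>k\<in>Poly_Mapping.keys p.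
     fps_const (of_rat (Poly_Mapping.lookup p k)) * fps_exp (exponent k))"

lemma exponent_add: "exponent (k + l) = exponent k + exponent l"
  by (simp add: exponent_def algebra_simps)

text \<open>This is the irrationality of \<open>sqrt 2\<close>: in \<open>a^2 = 2 b^2\<close> with
  \<open>b \<noteq> 0\<close> the multiplicity of the prime 2 would be even on the left and odd on
  the right.\<close>

lemma inj_exponent: "inj exponent"
proof (rule injI)
  fix k l assume kl: "exponent k = exponent l"
  define a b where "a = fst k - fst l" and "b = snd l - snd k"
  have "real_of_int a = sqrt 2 * real_of_int b"
    using kl by (simp add: a_def b_def exponent_def algebra_simps)
  then have "(real_of_int a)\<^sup>2 = 2 * (real_of_int b)\<^sup>2"
    by (simp add: power_mult_distrib)
  then have ab: "a\<^sup>2 = 2 * b\<^sup>2"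
    by (metis of_int_eq_iff of_int_mult of_int_numeral of_int_power)
  have "b = 0"
  proof (rule ccontr)
    assume b: "b \<noteq> 0"
    then have a: "a \<noteq> 0" using ab by auto
    have "multiplicity 2 (a\<^sup>2) = 2 * multiplicity 2 a"
      using a by (simp add: prime_elem_multiplicity_power_distrib)
    moreover have "multiplicity 2 (2 * b\<^sup>2) = Suc (2 * multiplicity 2 b)"
      using b by (simp add: prime_elem_multiplicity_mult_distrib prime_elem_multiplicity_power_distrib)
    ultimately have "2 * multiplicity 2 a = Suc (2 * multiplicity 2 b)"
      using ab by simp
    then show False by presburger
  qed
  with ab show "k = l" by (simp add: a_def b_def prod_eq_iff)
qed

lemma expand_superset:
  assumes "finite A" "Poly_Mapping.keys p \<subseteq> A"
  shows "expand p = (\<Sum>k\<in>A. fps_const (of_rat (Poly_Mapping.lookup p k)) * fps_exp (exponent k))"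
  unfolding expand_def using assms by (intro sum.mono_neutral_left) (auto simp: in_keys_iff)

lemma expand_0 [simp]: "expand 0 = 0"
  by (simp add: expand_def)

lemma expand_single: "expand (Poly_Mapping.single k c) = fps_const (of_rat c) * fps_exp (exponent k)"
  by (simp add: expand_superset[of "{k}"])

lemma expand_1 [simp]: "expand 1 = 1"
  using expand_single[of 0 1] by (simp add: exponent_def)

lemma expand_add: "expand (p + q) = expand p + expand q"
proof -
  let ?A = "Poly_Mapping.keys p \<union> Poly_Mapping.keys q"
  have "Poly_Mapping.keys (p + q) \<subseteq> ?A" by (rule keys_add)
  then show ?thesis
    by (simp add: expand_superset[of ?A] lookup_add of_rat_add sum.distrib algebra_simps
        flip: fps_const_add)
qed

lemma expand_diff: "expand (p - q) = expand p - expand q"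
  using expand_add[of "p - q" q] by simp

lemma expand_sum: "expand (\<Sum>i\<in>I. f i) = (\<Sum>i\<in>I. expand (f i))"
  by (induction I rule: infinite_finite_induct) (simp_all add: expand_add)

text \<open>By bilinearity monomials suffice, where the claim is
  \<open>exp ((a + b) h) = exp (a h) exp (b h)\<close>. Both factors are built up one monomial at a
  time, since updating a fresh key adds a monomial.\<close>

lemma expand_mult: "expand (p * q) = expand p * expand q"
proof (induction p rule: update_induct)
  case const
  then show ?case by simp
next
  case (update p k a)
  have upd: "Poly_Mapping.update l c r = r + Poly_Mapping.single l c"
    if "l \<notin> Poly_Mapping.keys r" for l c and r :: laurent2
    using that by (intro poly_mapping_eqI)
      (auto simp: lookup_update lookup_add lookup_single when_def in_keys_iff)
  have "expand (Poly_Mapping.single k a * q) = expand (Poly_Mapping.single k a) * expand q" for q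
  proof (induction q rule: update_induct)
    case (update q l b)
    then show ?case
      by (simp add: upd expand_add algebra_simps mult_single expand_single exponent_add
          fps_exp_add_mult of_rat_mult flip: fps_const_mult)
  qed simp
  then show ?case using update by (simp add: upd expand_add algebra_simps)
qed

text \<open>Vanishing of all derivatives at 0 says that a combination of exponentials kills all
  polynomials evaluated at the exponents; a Lagrange polynomial then isolates one coefficient.\<close>
lemma expand_eq_0_iff: "expand p = 0 \<longleftrightarrow> p = 0"
proof
  assume p: "expand p = 0"
  let ?c = "\<lambda>k. real_of_rat (Poly_Mapping.lookup p k)"
  have moment: "(\<Sum>k\<in>Poly_Mapping.keys p. ?c k * exponent k ^ i) = 0" for i
  proof -
    have "(\<Sum>k\<in>Poly_Mapping.keys p. ?c k * (exponent k ^ i / fact i)) = 0"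
      using arg_cong[OF p, of "\<lambda>f. fps_nth f i"] by (simp add: expand_def fps_sum_nth)
    then show ?thesis
      by (simp flip: sum_divide_distrib)
  qed
  have vanish: "(\<Sum>k\<in>Poly_Mapping.keys p. ?c k * poly f (exponent k)) = 0" for f
  proof -
    have "(\<Sum>k\<in>Poly_Mapping.keys p. ?c k * poly f (exponent k))
        = (\<Sum>i\<le>degree f. coeff f i * (\<Sum>k\<in>Poly_Mapping.keys p. ?c k * exponent k ^ i))"
      by (simp add: poly_altdef sum_distrib_left mult_ac sum.swap[of _ "{..degree f}"])
    then show ?thesis by (simp add: moment)
  qed
  show "p = 0"
  proof (rule ccontr)
    assume "p \<noteq> 0"
    then obtain k where k: "k \<in> Poly_Mapping.keys p"
      by (metis keys_eq_empty all_not_in_conv)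
    define f where "f = (\<Prod>l\<in>Poly_Mapping.keys p - {k}. [:- exponent l, 1:])"
    have f: "poly f (exponent l) = (\<Prod>m\<in>Poly_Mapping.keys p - {k}. exponent l - exponent m)" for l
      by (simp add: f_def poly_prod)
    have "(\<Sum>l\<in>Poly_Mapping.keys p. ?c l * poly f (exponent l)) = ?c k * poly f (exponent k)"
      using k by (subst sum.remove[OF _ k]) (auto simp: f intro!: sum.neutral)
    moreover have "poly f (exponent k) \<noteq> 0"
      using inj_exponent by (auto simp: f dest: injD)
    ultimately show False using vanish[of f] k by (simp add: in_keys_iff)
  qed
qed simp

section \<open>The order filtration on Laurent polynomials\<close>

definition ord_ge :: "nat \<Rightarrow> laurent2 set" where
  "ord_ge n = {p. \<forall>i<n. fps_nth (expand p) i = 0}"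

lemma ord_ge_0 [simp]: "ord_ge 0 = UNIV"
  by (simp add: ord_ge_def)

lemma zero_ord_ge [simp]: "0 \<in> ord_ge n"
  by (simp add: ord_ge_def)

lemma add_ord_ge: "p \<in> ord_ge n \<Longrightarrow> q \<in> ord_ge n \<Longrightarrow> p + q \<in> ord_ge n"
  by (simp add: ord_ge_def expand_add)

lemma diff_ord_ge: "p \<in> ord_ge n \<Longrightarrow> q \<in> ord_ge n \<Longrightarrow> p - q \<in> ord_ge n"
  by (simp add: ord_ge_def expand_diff)

lemma ord_ge_Suc: "ord_ge (Suc n) \<subseteq> ord_ge n"
  by (auto simp: ord_ge_def)

lemma mult_ord_ge: "p \<in> ord_ge m \<Longrightarrow> q \<in> ord_ge n \<Longrightarrow> p * q \<in> ord_ge (m + n)"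
  unfolding ord_ge_def mem_Collect_eq expand_mult fps_mult_nth
proof (intro allI impI sum.neutral ballI)
  fix i j assume "\<forall>i<m. fps_nth (expand p) i = 0" "\<forall>i<n. fps_nth (expand q) i = 0"
    "i < m + n" "j \<in> {0..i}"
  then show "fps_nth (expand p) j * fps_nth (expand q) (i - j) = 0"
    by (cases "j < m") auto
qed

text \<open>An expansion vanishing to all orders is zero, and the injectivity of
  \<open>expand\<close> carries this back to \<open>p\<close>.\<close>

lemma Inter_ord_ge: "(\<And>n. p \<in> ord_ge n) \<Longrightarrow> p = 0"
  using expand_eq_0_iff[of p] unfolding ord_ge_def fps_eq_iff by fastforce

lemma ord_ge_isolated: "0 < m \<Longrightarrow> (\<Sum>i<m::nat. p) \<in> ord_ge n \<Longrightarrow> p \<in> ord_ge n"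
  by (simp add: ord_ge_def expand_sum fps_sum_nth del: sum_constant) simp

lemma mem_ord_ge_1: "p \<in> ord_ge (Suc 0) \<longleftrightarrow> fps_nth (expand p) 0 = 0"
  by (simp add: ord_ge_def)

lemma expand_lx_0 [simp]: "fps_nth (expand lx) 0 = 1"
  by (simp add: lx_def expand_single)

lemma expand_ly_0 [simp]: "fps_nth (expand ly) 0 = 1"
  by (simp add: ly_def expand_single)

text \<open>Taking the constant coefficient sets \<open>h = 0\<close>, that is,
  \<open>x = y = 1\<close>.\<close>

lemma expand_poly_at_ly_0: "fps_nth (expand (poly_at_ly p)) 0 = of_rat (poly p 1)"
  unfolding poly_at_ly_def
  by (induction p)
    (auto simp: map_poly_pCons single_zero expand_add expand_mult expand_single exponent_def of_rat_add)


section \<open>Roots and depth\<close>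

lemma single_eq_0_iff [simp]: "Poly_Mapping.single k c = 0 \<longleftrightarrow> c = 0"
  by (metis lookup_single_eq lookup_zero single_zero)

locale faithful_paris =
  fixes S :: "'s set" and M :: "'s \<Rightarrow> 's \<Rightarrow> enat"
    and \<Psi> :: "'s gword set \<Rightarrow> (('s \<Rightarrow>\<^sub>0 real) \<Rightarrow>\<^sub>0 laurent2) \<Rightarrow> (('s \<Rightarrow>\<^sub>0 real) \<Rightarrow>\<^sub>0 laurent2)"
  assumes finite_S: "finite S" and coxeter: "coxeter_matrix S M" and small: "small_matrix S M"
    and rep: "paris_representation S M \<Psi>"
    and inj: "inj_on \<Psi> (carrier (artin_group S M))"
begin

abbreviation refl :: "'s \<Rightarrow> ('s \<Rightarrow>\<^sub>0 real) \<Rightarrow> 's \<Rightarrow>\<^sub>0 real" where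
  "refl \<equiv> reflection S M"

abbreviation coroot :: "'s \<Rightarrow> ('s \<Rightarrow>\<^sub>0 real) \<Rightarrow> real" where
  "coroot s \<equiv> bform S M (simple_root s)"

abbreviation pos :: "('s \<Rightarrow>\<^sub>0 real) set" where
  "pos \<equiv> pos_roots S M"

abbreviation V :: "(('s \<Rightarrow>\<^sub>0 real) \<Rightarrow>\<^sub>0 laurent2) set" where
  "V \<equiv> paris_V S M"

lemma coroot_eq:
  assumes "s \<in> S"
  shows "coroot s u = (\<Sum>q\<in>S. Poly_Mapping.lookup u q * gram M s q)"
proof -
  have "coroot s u = (\<Sum>r\<in>S. if r = s then (\<Sum>q\<in>S. Poly_Mapping.lookup u q * gram M s q) else 0)"
    unfolding bform_def simple_root_def by (intro sum.cong) (auto simp: lookup_single)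
  then show ?thesis using finite_S assms by simp
qed

lemma coroot_diff: "s \<in> S \<Longrightarrow> coroot s (u - v) = coroot s u - coroot s v"
  by (simp add: coroot_eq lookup_minus left_diff_distrib sum_subtractf)

lemma coroot_uminus: "s \<in> S \<Longrightarrow> coroot s (- u) = - coroot s u"
  by (simp add: coroot_eq sum_negf)

lemma coroot_single:
  assumes "s \<in> S" "t \<in> S"
  shows "coroot s (Poly_Mapping.single t c) = c * gram M s t"
proof -
  have "coroot s (Poly_Mapping.single t c) = (\<Sum>q\<in>S. if q = t then c * gram M s t else 0)"
    unfolding coroot_eq[OF assms(1)] by (intro sum.cong) (auto simp: lookup_single)
  then show ?thesis using finite_S assms by simp
qed

lemma coroot_simple: "s \<in> S \<Longrightarrow> t \<in> S \<Longrightarrow> coroot s (simple_root t) = gram M s t"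
  using coroot_single[of s t 1] by (simp add: simple_root_def)

lemma gram_cases:
  assumes "s \<in> S" "t \<in> S"
  obtains "s = t" "gram M s t = 2" | "s \<noteq> t" "gram M s t = 0" | "s \<noteq> t" "gram M s t = -1"
  using gram_small(1)[OF coxeter small assms] by (auto split: if_splits)

lemma gram_sym: "s \<in> S \<Longrightarrow> t \<in> S \<Longrightarrow> gram M s t = gram M t s"
  by (rule gram_small(2)[OF coxeter small])

lemma gram_self: "s \<in> S \<Longrightarrow> gram M s s = 2"
  using gram_small(1)[OF coxeter small, of s s] by simp

lemma refl_uminus: "s \<in> S \<Longrightarrow> refl s (- u) = - refl s u"
  by (simp add: reflection_def coroot_uminus single_uminus)

lemma coroot_refl: "s \<in> S \<Longrightarrow> t \<in> S \<Longrightarrow> coroot s (refl t u) = coroot s u - coroot t u * gram M s t"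
  by (simp add: reflection_def coroot_diff coroot_single)

lemma refl_refl [simp]: "s \<in> S \<Longrightarrow> refl s (refl s u) = u"
  by (simp add: reflection_def[of _ _ _ "refl s u"] coroot_refl gram_self)
    (simp add: reflection_def flip: single_uminus)

lemma refl_eq_iff: "s \<in> S \<Longrightarrow> refl s u = v \<longleftrightarrow> u = refl s v"
  by auto

lemma refl_simple:
  "s \<in> S \<Longrightarrow> t \<in> S \<Longrightarrow> refl s (simple_root t) = simple_root t - Poly_Mapping.single s (gram M s t)"
  by (simp add: reflection_def simple_root_def coroot_single[unfolded simple_root_def])

lemma refl_simple_self: "s \<in> S \<Longrightarrow> refl s (simple_root s) = - simple_root s"
  unfolding refl_simple[of s s] gram_self
  by (intro poly_mapping_eqI) (simp add: refl_simple gram_self simple_root_def lookup_minus lookup_single when_def)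

lemma word_action_simps [simp]:
  "word_action S M [] u = u"
  "word_action S M (a # w) u = refl (fst a) (word_action S M w u)"
  "word_action S M (w @ w') u = word_action S M w (word_action S M w' u)"
  by (simp_all add: word_action_def split_def)

text \<open>Replaces elements of the Coxeter group by words, which makes induction on words
  available for roots.\<close>

lemma mem_roots:
  "\<beta> \<in> roots S M \<longleftrightarrow> (\<exists>w\<in>gwords S. \<exists>s\<in>S. \<beta> = word_action S M w (simple_root s))"
proof -
  let ?cls = "pres_class S (coxeter_rels S M)"
  have "carrier (coxeter_group S M) = ?cls ` gwords S"
    by (simp add: coxeter_group_def presented_group_def)
  then have "\<beta> \<in> roots S M \<longleftrightarrow> (\<exists>X\<in>?cls ` gwords S. \<exists>s\<in>S. \<beta> = coxeter_action S M X (simple_root s))" for \<beta>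
    unfolding roots_def by auto
  then have "\<beta> \<in> roots S M \<longleftrightarrow> (\<exists>w\<in>gwords S. \<exists>s\<in>S. \<beta> = word_action S M w (simple_root s))" for \<beta>
    using coxeter_action_class[OF finite_S coxeter small] by (simp cong: bex_cong)
  then show ?thesis .
qed

lemma root_induct [consumes 1, case_names simple refl]:
  assumes "\<beta> \<in> roots S M"
    and "\<And>s. s \<in> S \<Longrightarrow> P (simple_root s)"
    and "\<And>s \<beta>. s \<in> S \<Longrightarrow> \<beta> \<in> roots S M \<Longrightarrow> P \<beta> \<Longrightarrow> P (refl s \<beta>)"
  shows "P \<beta>"
proof -
  obtain w t where t: "t \<in> S" and w: "w \<in> gwords S" "\<beta> = word_action S M w (simple_root t)"
    using assms(1) by (auto simp: mem_roots)
  show ?thesis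
    using w
  proof (induction w arbitrary: \<beta>)
    case Nil
    show ?case unfolding Nil(2) word_action_simps by (rule assms(2)[OF t])
  next
    case (Cons a w)
    have "word_action S M w (simple_root t) \<in> roots S M"
      unfolding mem_roots using Cons.prems t by (intro bexI[of _ w] bexI[of _ t]) auto
    moreover have "fst a \<in> S" "P (word_action S M w (simple_root t))"
      using Cons by simp_all
    ultimately show ?case
      unfolding Cons.prems(2) word_action_simps by (intro assms(3))
  qed
qed

lemma simple_root_in_roots: "s \<in> S \<Longrightarrow> simple_root s \<in> roots S M"
  unfolding mem_roots by (intro bexI[of _ "[]"] bexI[of _ s]) auto

lemma refl_in_roots: "s \<in> S \<Longrightarrow> \<beta> \<in> roots S M \<Longrightarrow> refl s \<beta> \<in> roots S M"
proof -
  assume s: "s \<in> S" and "\<beta> \<in> roots S M"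
  then obtain w t where w: "w \<in> gwords S" "t \<in> S" "\<beta> = word_action S M w (simple_root t)"
    by (auto simp: mem_roots)
  then show ?thesis
    using s unfolding mem_roots by (intro bexI[of _ "(s, True) # w"] bexI[of _ t]) simp_all
qed

lemma keys_root:
  assumes "\<beta> \<in> roots S M"
  shows "Poly_Mapping.keys \<beta> \<subseteq> S"
  using assms
proof (induction rule: root_induct)
  case (refl s \<beta>)
  then show ?case
    using keys_diff[of \<beta> "Poly_Mapping.single s (coroot s \<beta>)"]
    by (auto simp: reflection_def split: if_splits)
qed (simp add: simple_root_def)

lemma root_nonzero: "\<beta> \<in> roots S M \<Longrightarrow> \<beta> \<noteq> 0"
proof (induction rule: root_induct)
  case (refl s \<beta>)
  have "refl s 0 = 0"
    using refl(1) by (simp add: reflection_def coroot_eq)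
  then show ?case
    using refl refl_eq_iff[of s \<beta> 0] by auto
qed (simp add: simple_root_def)

lemma pos_root: "\<beta> \<in> pos \<Longrightarrow> \<beta> \<in> roots S M"
  by (simp add: pos_roots_def)

lemma simple_root_pos: "s \<in> S \<Longrightarrow> simple_root s \<in> pos"
  by (simp add: pos_roots_def simple_root_in_roots) (simp add: simple_root_def lookup_single when_def)

lemma pos_not_neg:
  assumes "\<beta> \<in> pos"
  shows "- \<beta> \<notin> pos"
proof
  assume "- \<beta> \<in> pos"
  then have "Poly_Mapping.lookup \<beta> s = 0" if "s \<in> S" for s
    using assms that by (fastforce simp: pos_roots_def intro: antisym)
  moreover have "Poly_Mapping.lookup \<beta> s = 0" if "s \<notin> S" for s
    using keys_root[OF pos_root[OF assms]] that by (auto simp: in_keys_iff)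
  ultimately have "\<beta> = 0"
    by (intro poly_mapping_eqI) auto
  then show False using root_nonzero pos_root[OF assms] by blast
qed

lemma mem_neg_roots: "\<beta> \<in> neg_roots S M \<longleftrightarrow> - \<beta> \<in> pos"
  unfolding neg_roots_def by (metis image_iff minus_minus)

lemma pos_neq_uminus_simple: "\<beta> \<in> pos \<Longrightarrow> s \<in> S \<Longrightarrow> \<beta> \<noteq> - simple_root s"
  using pos_not_neg simple_root_pos by auto

section \<open>The module \<open>V\<close> and the action of the Artin group\<close>

lemma V_add: "u \<in> V \<Longrightarrow> v \<in> V \<Longrightarrow> u + v \<in> V"
  using keys_add[of u v] by (auto simp: paris_V_def)

lemma V_diff: "u \<in> V \<Longrightarrow> v \<in> V \<Longrightarrow> u - v \<in> V"
  using keys_diff[of u v] by (auto simp: paris_V_def)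

lemma V_0: "0 \<in> V"
  by (simp add: paris_V_def)

lemma V_lscale: "v \<in> V \<Longrightarrow> lscale c v \<in> V"
  using mult_not_zero unfolding paris_V_def by (simp add: subset_iff in_keys_iff) blast

lemma V_ebasis: "\<beta> \<in> pos \<Longrightarrow> ebasis \<beta> \<in> V"
  by (simp add: paris_V_def ebasis_def)

lemma V_sum: "(\<And>i. i \<in> I \<Longrightarrow> f i \<in> V) \<Longrightarrow> sum f I \<in> V"
  by (induction I rule: infinite_finite_induct) (simp_all add: V_0 V_add)

abbreviation cls :: "'s gword \<Rightarrow> 's gword set" where
  "cls w \<equiv> pres_class S (artin_rels S M) w"

lemma carrier_artin: "carrier (artin_group S M) = cls ` gwords S"
  by (simp add: artin_group_def presented_group_def)

lemma one_artin: "\<one>\<^bsub>artin_group S M\<^esub> = cls []"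
  by (simp add: artin_group_def presented_group_def)

lemma mult_artin: "u \<in> gwords S \<Longrightarrow> v \<in> gwords S \<Longrightarrow> cls u \<otimes>\<^bsub>artin_group S M\<^esub> cls v = cls (u @ v)"
  by (simp add: artin_group_def mult_pres_class)

lemma group_artin: "group (artin_group S M)"
  by (simp add: artin_group_def group_presented_group)

lemma Psi_hom: "\<Psi> \<in> hom (artin_group S M) (GL_group V)"
  using rep by (simp add: paris_representation_def)

lemma Psi_GL:
  assumes "g \<in> carrier (artin_group S M)"
  shows "\<Psi> g \<in> Bij V" "lin_on V (\<Psi> g)"
  using hom_in_carrier[OF Psi_hom assms] by (simp_all add: GL_group_def)

lemma Psi_V: "g \<in> carrier (artin_group S M) \<Longrightarrow> v \<in> V \<Longrightarrow> \<Psi> g v \<in> V"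
  using Psi_GL(1) Bij_imp_funcset by blast

lemma Psi_mult:
  assumes "g \<in> carrier (artin_group S M)" "h \<in> carrier (artin_group S M)" "v \<in> V"
  shows "\<Psi> (g \<otimes>\<^bsub>artin_group S M\<^esub> h) v = \<Psi> g (\<Psi> h v)"
  using hom_mult[OF Psi_hom assms(1,2)] assms Psi_GL(1)
  by (simp add: GL_group_def BijGroup_def compose_def)

lemma Psi_one_eq: "\<Psi> \<one>\<^bsub>artin_group S M\<^esub> = (\<lambda>v\<in>V. v)"
  using hom_one[OF Psi_hom group_artin group_GL_group] by (simp add: GL_group_def BijGroup_def)

lemma Psi_one: "v \<in> V \<Longrightarrow> \<Psi> \<one>\<^bsub>artin_group S M\<^esub> v = v"
  by (simp add: Psi_one_eq)

lemma Psi_faithful: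
  assumes g: "g \<in> carrier (artin_group S M)" and "\<And>v. v \<in> V \<Longrightarrow> \<Psi> g v = v"
  shows "g = \<one>\<^bsub>artin_group S M\<^esub>"
proof -
  \<comment> \<open>Members of \<open>Bij V\<close> are extensional, so agreement on
    \<open>V\<close> is equality of functions and injectivity of \<open>\<Psi>\<close>
    applies.\<close>
  have "\<Psi> g = \<Psi> \<one>\<^bsub>artin_group S M\<^esub>"
    unfolding Psi_one_eq using assms Bij_imp_extensional[OF Psi_GL(1)[OF g]]
    by (auto intro!: extensionalityI[where A = V])
  then show ?thesis
    using inj_onD[OF inj] g group.is_monoid[OF group_artin] monoid.one_closed by metis
qed

lemma Psi_gen: "s \<in> S \<Longrightarrow> \<Psi> (cls [(s, True)]) = paris_psi S M s"
  using rep by (simp add: paris_representation_def artin_gen_def)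

text \<open>Holds because \<open>paris_psi S M s\<close> is the value of \<open>\<Psi>\<close> at a
  generator and \<open>\<Psi>\<close> takes values in GL(V); no knowledge of the roots
  enters.\<close>

lemma psi_V: "s \<in> S \<Longrightarrow> v \<in> V \<Longrightarrow> paris_psi S M s v \<in> V"
  using Psi_V[of "cls [(s, True)]" v] by (simp add: Psi_gen carrier_artin)

text \<open>That \<open>\<psi>\<^sub>s\<close> preserves \<open>V\<close> already contains the fact that \<open>s\<close> permutes the positive roots other
  than \<open>\<alpha>\<^sub>s\<close>, since \<open>e\<^bsub>s\<beta>\<^esub>\<close> occurs in \<open>\<psi>\<^sub>s(e\<^sub>\<beta>)\<close>.\<close>
lemma refl_pos:
  assumes s: "s \<in> S" and \<beta>: "\<beta> \<in> pos" and ne: "\<beta> \<noteq> simple_root s"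
  shows "refl s \<beta> \<in> pos"
proof (cases "coroot s \<beta> = 0")
  case True
  then show ?thesis using \<beta> by (simp add: reflection_def)
next
  case False
  \<comment> \<open>\<open>ns\<close> and \<open>n\<beta>\<close> keep the \<open>T\<close> term and
    the term \<open>(1 - y) e_\<beta>\<close> away from the coefficient at
    \<open>refl s \<beta>\<close>, which is therefore \<open>y\<close> or \<open>1\<close>.\<close>
  have ns: "refl s \<beta> \<noteq> simple_root s"
    using pos_neq_uminus_simple[OF \<beta> s] refl_eq_iff[OF s, of \<beta> "simple_root s"]
    unfolding refl_simple_self[OF s] by blast
  have n\<beta>: "refl s \<beta> \<noteq> \<beta>"
    using False by (simp add: reflection_def)
  have ly0: "ly \<noteq> 0"
    using expand_ly_0 by force
  have "paris_psi_basis S M s \<beta> \<in> V"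
    using psi_V[OF s V_ebasis[OF \<beta>]] paris_psi_ebasis[OF \<beta>] by simp
  moreover have "Poly_Mapping.lookup (paris_psi_basis S M s \<beta>) (refl s \<beta>) \<noteq> 0"
  proof (cases "coroot s \<beta> > 0")
    case True
    then have "refl s \<beta> = \<beta> - Poly_Mapping.single s \<bar>coroot s \<beta>\<bar>"
      by (simp add: reflection_def)
    then show ?thesis
      using True ne ns ly0
      by (simp add: paris_psi_basis_def paris_phi_basis_def lookup_add ebasis_def lookup_single Let_def)
  next
    case neg: False
    then have "refl s \<beta> = \<beta> + Poly_Mapping.single s \<bar>coroot s \<beta>\<bar>"
      using False by (simp add: reflection_def single_uminus)
    then show ?thesis
      using False neg ne ns n\<beta>
      by (simp add: paris_psi_basis_def paris_phi_basis_def lookup_add ebasis_def lookup_single Let_def)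
  qed
  ultimately show ?thesis
    by (auto simp: paris_V_def in_keys_iff)
qed

text \<open>By \<open>refl_pos\<close>, \<open>refl s\<close> preserves the sign of every root
  except the simple root of \<open>s\<close> and its negative, which it exchanges.\<close>

lemma root_pos_or_neg: "\<beta> \<in> roots S M \<Longrightarrow> \<beta> \<in> pos \<or> - \<beta> \<in> pos"
proof (induction rule: root_induct)
  case (refl s \<beta>)
  then show ?case
    using refl_pos[of s \<beta>] refl_pos[of s "- \<beta>"] refl_simple_self[of s] simple_root_pos[of s] refl_uminus[of s \<beta>]
    by (metis minus_minus)
qed (simp add: simple_root_pos)

section \<open>Depth in terms of positive words\<close>

lemma pres_eq_pos_word:
  "w \<in> gwords S \<Longrightarrow> pres_eq S (coxeter_rels S M) w (pos_word (map fst w))"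
proof (induction w)
  case (Cons a w)
  obtain s b where a: "a = (s, b)" by force
  have s: "s \<in> S" using Cons.prems a by simp
  have "pres_eq S (coxeter_rels S M) [(s, b)] [(s, True)]"
  proof (cases b)
    case False
    \<comment> \<open>\<open>s^-1 = s^-1 s s = s\<close>, first by the relation
      \<open>s s = 1\<close> and then by cancellation.\<close>
    have "pres_eq S (coxeter_rels S M) [(s, True), (s, True)] []"
      using s by (intro pres_eq.rel) (auto simp: coxeter_rels_def pos_word_def)
    then have "pres_eq S (coxeter_rels S M) ([(s, False)] @ [(s, True), (s, True)]) ([(s, False)] @ [])"
      using s by (intro pres_eq.append pres_eq.refl) auto
    moreover have "pres_eq S (coxeter_rels S M) [(s, False), (s, True)] []"
      using pres_eq.cancel[of s S _ False] s by simp
    then have "pres_eq S (coxeter_rels S M) ([(s, False), (s, True)] @ [(s, True)]) ([] @ [(s, True)])"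
      using s by (intro pres_eq.append pres_eq.refl) auto
    ultimately show ?thesis
      using False pres_eq.sym pres_eq.trans by fastforce
  qed (use s in \<open>simp add: pres_eq.refl\<close>)
  then have "pres_eq S (coxeter_rels S M) ([(s, b)] @ w) ([(s, True)] @ pos_word (map fst w))"
    using Cons by (intro pres_eq.append) auto
  then show ?case by (simp add: a)
qed (simp add: pres_eq.refl)

text \<open>With \<open>root_depth_attained\<close> this describes the depth as the least length of
  a positive word making \<beta> negative, replacing the two nested minima over group elements and
  their words.\<close>

lemma root_depth_le:
  assumes w: "w \<in> lists S" and neg: "- word_action S M (pos_word w) \<beta> \<in> pos"
  shows "root_depth S M \<beta> \<le> length w"
proof -
  let ?X = "pres_class S (coxeter_rels S M) (pos_word w)"
  have g: "pos_word w \<in> gwords S" using w by auto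
  have "root_depth S M \<beta> \<le> coxeter_length S M ?X"
    unfolding root_depth_def
  proof (rule Least_le, intro bexI conjI)
    show "coxeter_action S M ?X \<beta> \<in> neg_roots S M"
      using neg coxeter_action_class[OF finite_S coxeter small g] by (simp add: mem_neg_roots)
  qed (use g in \<open>simp_all add: coxeter_group_def presented_group_def\<close>)
  also have "\<dots> \<le> length w"
    unfolding coxeter_length_def using w by (intro Least_le) blast
  finally show ?thesis .
qed

lemma root_depth_attained:
  assumes \<beta>: "\<beta> \<in> pos"
  obtains w where "w \<in> lists S" "length w = root_depth S M \<beta>"
    "- word_action S M (pos_word w) \<beta> \<in> pos"
proof -
  have carr: "carrier (coxeter_group S M) = pres_class S (coxeter_rels S M) ` gwords S"
    by (simp add: coxeter_group_def presented_group_def)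
  \<comment> \<open>The minimum is meaningful only if some word works: undo the reflections leading
    from a simple root to \<beta>, then apply that simple reflection.\<close>
  have "\<exists>w\<in>gwords S. - word_action S M w \<beta> \<in> pos"
    using pos_root[OF \<beta>]
  proof (induction rule: root_induct)
    case (simple s)
    then show ?case
      using simple_root_pos refl_simple_self by (intro bexI[of _ "[(s, True)]"]) auto
  next
    case (refl s \<beta>)
    then obtain w where "w \<in> gwords S" "- word_action S M w \<beta> \<in> pos" by auto
    then show ?case
      using refl(1) by (intro bexI[of _ "w @ [(s, True)]"]) auto
  qed
  then obtain w where w: "w \<in> gwords S" "- word_action S M w \<beta> \<in> pos" by auto
  have "\<exists>n. \<exists>X\<in>carrier (coxeter_group S M).
      coxeter_length S M X = n \<and> coxeter_action S M X \<beta> \<in> neg_roots S M"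
    using w coxeter_action_class[OF finite_S coxeter small w(1)]
    by (intro exI bexI[of _ "pres_class S (coxeter_rels S M) w"] conjI HOL.refl)
      (simp_all add: carr mem_neg_roots)
  then have "\<exists>X\<in>carrier (coxeter_group S M).
      coxeter_length S M X = root_depth S M \<beta> \<and> coxeter_action S M X \<beta> \<in> neg_roots S M"
    unfolding root_depth_def by (rule LeastI_ex)
  then obtain v where v: "v \<in> gwords S"
    "coxeter_length S M (pres_class S (coxeter_rels S M) v) = root_depth S M \<beta>"
    "coxeter_action S M (pres_class S (coxeter_rels S M) v) \<beta> \<in> neg_roots S M"
    by (auto simp: carr)
  let ?X = "pres_class S (coxeter_rels S M) v"
  have "\<exists>n. \<exists>u\<in>lists S. length u = n \<and> ?X = pres_class S (coxeter_rels S M) (pos_word u)"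
    using pres_eq_pos_word[OF v(1)] v(1) pres_class_eq_iff[OF v(1), of "coxeter_rels S M"]
    by (intro exI bexI[of _ "map fst v"] conjI HOL.refl) (auto simp: gwords_def mem_Times_iff)
  then have "\<exists>u\<in>lists S. length u = coxeter_length S M ?X \<and> ?X = pres_class S (coxeter_rels S M) (pos_word u)"
    unfolding coxeter_length_def by (rule LeastI_ex)
  then obtain u where u: "u \<in> lists S" "length u = root_depth S M \<beta>"
    "?X = pres_class S (coxeter_rels S M) (pos_word u)"
    using v(2) by auto
  moreover have "- word_action S M (pos_word u) \<beta> \<in> pos"
    using v(3) u coxeter_action_class[OF finite_S coxeter small, of "pos_word u"]
    by (simp add: mem_neg_roots lists_eq_set)
  ultimately show ?thesis using that by blast
qed

lemma root_depth_simple: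
  assumes s: "s \<in> S"
  shows "root_depth S M (simple_root s) = 1"
proof -
  note p = simple_root_pos[OF s]
  obtain w where "length w = root_depth S M (simple_root s)"
    "- word_action S M (pos_word w) (simple_root s) \<in> pos"
    using root_depth_attained[OF p] by metis
  then have "root_depth S M (simple_root s) \<noteq> 0"
    using pos_not_neg[OF p] by (cases w) auto
  moreover have "root_depth S M (simple_root s) \<le> 1"
    using root_depth_le[of "[s]" "simple_root s"] s p by (simp add: refl_simple_self)
  ultimately show ?thesis by simp
qed

text \<open>The last letter \<open>t\<close> of a shortest word making \<beta> negative acts first.
  Dropping it lowers the depth by at least one, and appending it to a shortest word for
  \<open>refl t \<beta>\<close> shows that the drop is at most one. Hence the choice of
  \<open>t\<close> in the recursion for \<open>T\<close> succeeds.\<close>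

lemma root_depth_descent:
  assumes \<beta>: "\<beta> \<in> pos" and d: "root_depth S M \<beta> \<noteq> 1"
  obtains t where "t \<in> S" "refl t \<beta> \<in> pos" "root_depth S M (refl t \<beta>) = root_depth S M \<beta> - 1"
proof -
  obtain w where w: "w \<in> lists S" "length w = root_depth S M \<beta>"
    "- word_action S M (pos_word w) \<beta> \<in> pos"
    using root_depth_attained[OF \<beta>] by metis
  then have "w \<noteq> []" using pos_not_neg[OF \<beta>] by auto
  then obtain u t where u: "w = u @ [t]" by (cases w rule: rev_cases) auto
  then have t: "t \<in> S" using w by simp
  have "\<beta> \<noteq> simple_root t" using d root_depth_simple t by auto
  then have pos: "refl t \<beta> \<in> pos" using refl_pos t \<beta> by blast
  have "root_depth S M (refl t \<beta>) \<le> length u"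
    using w u by (intro root_depth_le) auto
  moreover obtain v where v: "v \<in> lists S" "length v = root_depth S M (refl t \<beta>)"
    "- word_action S M (pos_word v) (refl t \<beta>) \<in> pos"
    using root_depth_attained[OF pos] by metis
  then have "root_depth S M \<beta> \<le> length (v @ [t])"
    using t by (intro root_depth_le) auto
  ultimately show ?thesis
    using that[OF t pos] w(2) u v(2) by simp
qed


section \<open>The Paris representation at \<open>x = y = 1\<close>\<close>

text \<open>Induction on the number of rounds. At \<open>y = 1\<close> all summands with a factor
  \<open>y - 1\<close> vanish, and the others are values of \<open>T\<close> to which the induction
  hypothesis applies as soon as the root is not the simple root of the index; \<open>ns\<close>,
  \<open>nt\<close> and \<open>IHst\<close> check this.\<close>

lemma paris_T_upto_at_1:
  assumes "s \<in> S" "\<beta> \<in> pos" "\<beta> \<noteq> simple_root s"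
  shows "poly (paris_T_upto S M n s \<beta>) 1 = 0"
  using assms
proof (induction n arbitrary: s \<beta>)
  case (Suc n)
  note s = \<open>s \<in> S\<close> and \<beta> = \<open>\<beta> \<in> pos\<close>
  show ?case
  proof (cases "root_depth S M \<beta> = 1 \<or> coroot s \<beta> > 0")
    case True
    show ?thesis
    proof (cases "root_depth S M \<beta> = 1")
      case True
      then have "paris_T_upto S M (Suc n) s \<beta> = 0"
        using \<open>\<beta> \<noteq> simple_root s\<close> by (simp only: paris_T_upto.simps if_True if_False simp_thms)
      then show ?thesis by simp
    next
      case False
      with True have "paris_T_upto S M (Suc n) s \<beta> = poly_y ^ root_depth S M \<beta> * (poly_y - 1)"
        by (simp only: paris_T_upto.simps Let_def if_True if_False simp_thms)
      then show ?thesis by simp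
    qed
  next
    case False
    define t where "t = (SOME t. t \<in> S \<and> refl t \<beta> \<in> pos \<and>
      root_depth S M (refl t \<beta>) = root_depth S M \<beta> - 1)"
    have "root_depth S M \<beta> \<noteq> 1" using False by blast
    then have "\<exists>t. t \<in> S \<and> refl t \<beta> \<in> pos \<and> root_depth S M (refl t \<beta>) = root_depth S M \<beta> - 1"
      using root_depth_descent[OF \<beta>] by blast
    then have "t \<in> S \<and> refl t \<beta> \<in> pos \<and> root_depth S M (refl t \<beta>) = root_depth S M \<beta> - 1"
      unfolding t_def by (rule someI_ex)
    then have t: "t \<in> S" and t\<beta>: "refl t \<beta> \<in> pos" by auto
    define b c where "b = coroot t \<beta>" and "c = coroot s \<beta>"
    have c: "c \<le> 0" using False by (simp add: c_def)
    \<comment> \<open>Otherwise \<beta> is the image of \<alpha>_s under \<open>t\<close>: this is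
      -\<alpha>_s if \<open>s = t\<close>, \<alpha>_s if the two are orthogonal, and else \<alpha>_s
      + \<alpha>_t, on which \<open>coroot s\<close> is \<open>2 - 1 > 0\<close>, against
      \<open>c \<le> 0\<close>.\<close>
    have ns: "refl t \<beta> \<noteq> simple_root s"
    proof
      assume "refl t \<beta> = simple_root s"
      then have eq: "\<beta> = refl t (simple_root s)" using refl_eq_iff[OF t] by simp
      show False
        using s t
      proof (cases rule: gram_cases)
        case 1
        then show ?thesis using eq pos_neq_uminus_simple[OF \<beta> s] unfolding 1(1)[symmetric] refl_simple_self[OF s] by blast
      next
        case 2
        then show ?thesis using eq Suc.prems gram_sym[OF s t] by (simp add: refl_simple s t)
      next
        case 3
        then show ?thesis
          using c eq gram_sym[OF s t] gram_self[OF s]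
          by (simp add: c_def coroot_refl s t coroot_simple)
      qed
    qed
    have nt: "refl t \<beta> \<noteq> simple_root t"
      using pos_neq_uminus_simple[OF \<beta> t] refl_eq_iff[OF t, of \<beta> "simple_root t"]
      unfolding refl_simple_self[OF t] by blast
    have IHs: "poly (paris_T_upto S M n s (refl t \<beta>)) 1 = 0"
      using Suc.IH s t\<beta> ns by blast
    have IHt: "poly (paris_T_upto S M n t (refl t \<beta>)) 1 = 0"
      using Suc.IH t t\<beta> nt by blast
    have diff: "\<beta> - Poly_Mapping.single t b = refl t \<beta>"
      by (simp add: b_def reflection_def)
    \<comment> \<open>One formula for two cases of the recursion: \<open>b + c\<close> is
      \<open>b\<close> when \<open>c = 0\<close> and \<open>b - a\<close> when
      \<open>c = -a\<close>. For Gram entry -1 the root is \<open>refl s (refl t \<beta>)\<close>;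
      if \<open>s = t\<close>, it is \<beta> itself.\<close>
    have IHst: "poly (paris_T_upto S M n t (\<beta> - Poly_Mapping.single s (b + c) - Poly_Mapping.single t b)) 1 = 0"
      if g: "gram M s t \<noteq> 0" and bc: "s = t \<Longrightarrow> c = 0"
      using s t
    proof (cases rule: gram_cases)
      case 1
      then have "c = 0" "b = 0" using bc by (simp_all add: b_def c_def)
      then show ?thesis using Suc.IH[of t \<beta>] Suc.prems 1 by simp
    next
      case 3
      have "coroot s (refl t \<beta>) = b + c"
        using 3 by (simp add: coroot_refl s t b_def c_def)
      then have "\<beta> - Poly_Mapping.single s (b + c) - Poly_Mapping.single t b = refl s (refl t \<beta>)"
        by (simp add: reflection_def[of _ _ s] flip: diff)
      moreover have "refl s (refl t \<beta>) \<in> pos"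
        using refl_pos[OF s t\<beta> ns] .
      \<comment> \<open>Otherwise \<open>refl t \<beta>\<close> is \<alpha>_s + \<alpha>_t, whose
        image under \<open>t\<close> is \<alpha>_s, so \<beta> would be the excluded root.\<close>
      moreover have "refl s (refl t \<beta>) \<noteq> simple_root t"
      proof
        assume "refl s (refl t \<beta>) = simple_root t"
        then have "refl t \<beta> = simple_root t + simple_root s"
          using refl_eq_iff[OF s, of "refl t \<beta>" "simple_root t"] 3 refl_simple[OF s t]
          by (simp add: simple_root_def[of s] single_uminus)
        then have "\<beta> = refl t (simple_root t + simple_root s)"
          using refl_eq_iff[OF t] by simp
        also have "\<dots> = simple_root s"
          using 3 gram_sym[OF s t] gram_self[OF t] coroot_diff[OF t, of "simple_root t" "- simple_root s"]
          by (simp add: reflection_def[of _ _ t] s t coroot_simple coroot_uminus simple_root_def[of t, symmetric])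
        finally show False using Suc.prems by simp
      qed
      ultimately show ?thesis using Suc.IH t by simp
    qed (use g in simp)
    have step: "paris_T_upto S M (Suc n) s \<beta> =
      (let T = paris_T_upto S M n; a = - c in
         if c = 0 then
           if gram M s t = 0 then poly_y * T s (\<beta> - Poly_Mapping.single t b)
           else (poly_y - 1) * T s (\<beta> - Poly_Mapping.single t b)
                + poly_y * T t (\<beta> - Poly_Mapping.single s b - Poly_Mapping.single t b)
         else
           if gram M s t = 0 then poly_y * T s (\<beta> - Poly_Mapping.single t b)
           else if b > a then (poly_y - 1) * T s (\<beta> - Poly_Mapping.single t b)
                + poly_y * T t (\<beta> - Poly_Mapping.single s (b - a) - Poly_Mapping.single t b)
           else if b = a then T t (\<beta> - Poly_Mapping.single t b)
                + (poly_y - 1) * T s (\<beta> - Poly_Mapping.single t b)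
           else poly_y * T s (\<beta> - Poly_Mapping.single t b) + T t (\<beta> - Poly_Mapping.single t b)
                + poly_y ^ (root_depth S M \<beta> - 1) * (1 - poly_y))"
      using False unfolding b_def c_def t_def by (simp only: paris_T_upto.simps Let_def if_False de_Morgan_disj simp_thms)
    \<comment> \<open>For \<open>s = t\<close> and \<open>c < 0\<close> this gives
      \<open>b < 0 < -c\<close>, so the branch \<open>b > a\<close>, where \<open>IHst\<close> is
      applied, has \<open>s \<noteq> t\<close>.\<close>
    have bc: "s = t \<Longrightarrow> b = c"
      by (simp add: b_def c_def)
    show ?thesis
    proof (cases "c = 0")
      case True
      then show ?thesis
        using IHs IHst unfolding step diff Let_def by simp
    next
      case False
      then show ?thesis
        using IHs IHt IHst bc c unfolding step diff Let_def by force
    qed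
  qed
qed simp

text \<open>A simple root has depth 1, so a single round is run and yields \<open>y^2\<close>, which
  is 1 at \<open>y = 1\<close>.\<close>

lemma paris_T_at_1:
  assumes s: "s \<in> S" and \<beta>: "\<beta> \<in> pos"
  shows "poly (paris_T S M s \<beta>) 1 = (if \<beta> = simple_root s then 1 else 0)"
  using paris_T_upto_at_1[OF assms] root_depth_simple[OF s] by (simp add: paris_T_def)

section \<open>The filtration of \<open>V\<close> by order\<close>

definition fil :: "nat \<Rightarrow> (('s \<Rightarrow>\<^sub>0 real) \<Rightarrow>\<^sub>0 laurent2) set" where
  "fil n = {v \<in> V. \<forall>\<beta>. Poly_Mapping.lookup v \<beta> \<in> ord_ge n}"

lemma fil_0: "fil 0 = V"
  by (simp add: fil_def)

lemma zero_fil: "0 \<in> fil n"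
  by (simp add: fil_def V_0)

lemma add_fil: "u \<in> fil n \<Longrightarrow> v \<in> fil n \<Longrightarrow> u + v \<in> fil n"
  by (simp add: fil_def V_add lookup_add add_ord_ge)

lemma diff_fil: "u \<in> fil n \<Longrightarrow> v \<in> fil n \<Longrightarrow> u - v \<in> fil n"
  by (simp add: fil_def V_diff lookup_minus diff_ord_ge)

lemma diff_fil_commute: "u - v \<in> fil n \<Longrightarrow> v - u \<in> fil n"
  using diff_fil[OF zero_fil, of "u - v" n] by simp

lemma diff_fil_trans: "u - v \<in> fil n \<Longrightarrow> v - w \<in> fil n \<Longrightarrow> u - w \<in> fil n"
  using add_fil[of "u - v" n "v - w"] by simp

lemma sum_fil: "(\<And>i. i \<in> I \<Longrightarrow> f i \<in> fil n) \<Longrightarrow> sum f I \<in> fil n"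
  by (induction I rule: infinite_finite_induct) (simp_all add: zero_fil add_fil)

lemma lscale_fil: "c \<in> ord_ge m \<Longrightarrow> v \<in> fil n \<Longrightarrow> lscale c v \<in> fil (m + n)"
  by (simp add: fil_def V_lscale mult_ord_ge)

lemma lin_on_sum:
  assumes f: "lin_on V f" and v: "v \<in> V"
  shows "f v = (\<Sum>\<beta>\<in>Poly_Mapping.keys v. lscale (Poly_Mapping.lookup v \<beta>) (f (ebasis \<beta>)))"
proof -
  have f0: "f 0 = 0"
    using f V_0 unfolding lin_on_def by (metis add_cancel_right_left add_0)
  have "f (\<Sum>\<beta>\<in>B. lscale (Poly_Mapping.lookup v \<beta>) (ebasis \<beta>))
      = (\<Sum>\<beta>\<in>B. lscale (Poly_Mapping.lookup v \<beta>) (f (ebasis \<beta>)))" if "finite B" "B \<subseteq> pos" for B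
    using that
  proof (induction B)
    case (insert \<beta> B)
    then have "(\<Sum>\<beta>\<in>B. lscale (Poly_Mapping.lookup v \<beta>) (ebasis \<beta>)) \<in> V" "ebasis \<beta> \<in> V"
      by (auto intro!: V_sum V_lscale V_ebasis)
    then show ?case
      using insert f V_lscale by (simp add: lin_on_def)
  qed (simp add: f0)
  moreover have "v = (\<Sum>\<beta>\<in>Poly_Mapping.keys v. lscale (Poly_Mapping.lookup v \<beta>) (ebasis \<beta>))"
  proof (rule poly_mapping_eqI)
    fix \<gamma>
    have "(\<Sum>\<beta>\<in>Poly_Mapping.keys v. Poly_Mapping.lookup v \<beta> * (1 when \<beta> = \<gamma>)) =
      (\<Sum>\<beta>\<in>Poly_Mapping.keys v. if \<beta> = \<gamma> then Poly_Mapping.lookup v \<gamma> else 0)"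
      by (intro sum.cong) auto
    also have "\<dots> = Poly_Mapping.lookup v \<gamma>"
      by (simp add: in_keys_iff)
    finally show "Poly_Mapping.lookup v \<gamma> = Poly_Mapping.lookup
        (\<Sum>\<beta>\<in>Poly_Mapping.keys v. lscale (Poly_Mapping.lookup v \<beta>) (ebasis \<beta>)) \<gamma>"
      by (simp add: lookup_sum ebasis_def lookup_single)
  qed
  ultimately show ?thesis
    using v by (metis (mono_tags, lifting) finite_keys mem_Collect_eq paris_V_def)
qed

text \<open>Linearity over Laurent polynomials reduces the comparison to basis vectors, as
  coordinates of order \<open>n\<close> multiply errors of order \<open>m\<close>. Taking
  \<open>g = 0\<close> and \<open>m = 0\<close> gives invariance of the filtration;
  \<open>g = id\<close> and \<open>m = 1\<close> gives unipotence.\<close>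

lemma lin_on_fil_diff:
  assumes f: "lin_on V f" and g: "lin_on V g" and v: "v \<in> fil n"
    and fg: "\<And>\<beta>. \<beta> \<in> pos \<Longrightarrow> f (ebasis \<beta>) - g (ebasis \<beta>) \<in> fil m"
  shows "f v - g v \<in> fil (n + m)"
proof -
  have vV: "v \<in> V" using v by (simp add: fil_def)
  have "f v - g v = (\<Sum>\<beta>\<in>Poly_Mapping.keys v.
      lscale (Poly_Mapping.lookup v \<beta>) (f (ebasis \<beta>) - g (ebasis \<beta>)))"
    unfolding lin_on_sum[OF f vV] lin_on_sum[OF g vV] sum_subtractf[symmetric]
    by (intro sum.cong poly_mapping_eqI HOL.refl) (simp add: lookup_minus right_diff_distrib)
  also have "\<dots> \<in> fil (n + m)"
    using v vV by (intro sum_fil lscale_fil fg) (auto simp: fil_def paris_V_def)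
  finally show ?thesis .
qed

lemma lin_on_0: "lin_on V (\<lambda>_. 0)"
  by (simp add: lin_on_def poly_mapping_eqI)

lemma lin_on_id: "lin_on V (\<lambda>v. v)"
  by (simp add: lin_on_def)

lemma Psi_diff:
  assumes g: "g \<in> carrier (artin_group S M)" and u: "u \<in> V" and v: "v \<in> V"
  shows "\<Psi> g (u - v) = \<Psi> g u - \<Psi> g v"
proof -
  have "\<Psi> g (u - v + v) = \<Psi> g (u - v) + \<Psi> g v"
    using Psi_GL(2)[OF g] V_diff[OF u v] v unfolding lin_on_def by blast
  then show ?thesis by simp
qed

lemma Psi_fil:
  assumes g: "g \<in> carrier (artin_group S M)" and v: "v \<in> fil n"
  shows "\<Psi> g v \<in> fil n"
  using lin_on_fil_diff[OF Psi_GL(2)[OF g] lin_on_0 v, of 0] Psi_V[OF g] V_ebasis by (simp add: fil_0)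

section \<open>Roots up to sign and the action modulo \<open>fil 1\<close>\<close>

definition abs_root :: "('s \<Rightarrow>\<^sub>0 real) \<Rightarrow> 's \<Rightarrow>\<^sub>0 real" where
  "abs_root \<beta> = (if \<beta> \<in> pos then \<beta> else - \<beta>)"

lemma abs_root_pos: "\<beta> \<in> roots S M \<Longrightarrow> abs_root \<beta> \<in> pos"
  using root_pos_or_neg by (auto simp: abs_root_def)

lemma abs_root_uminus: "\<beta> \<in> roots S M \<Longrightarrow> abs_root (- \<beta>) = abs_root \<beta>"
  using root_pos_or_neg[of \<beta>] pos_not_neg[of \<beta>] by (auto simp: abs_root_def)

text \<open>Signs may be discarded before reflecting, so the reflections act on roots up to
  sign.\<close>

lemma abs_root_refl:
  assumes "s \<in> S" "\<beta> \<in> roots S M"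
  shows "abs_root (refl s (abs_root \<beta>)) = abs_root (refl s \<beta>)"
  using abs_root_uminus[OF refl_in_roots[OF assms]] refl_uminus[OF assms(1)]
  by (auto simp: abs_root_def[of \<beta>])

lemma ebasis_diff_fil:
  assumes v: "v \<in> V" and \<gamma>: "\<gamma> \<in> pos"
    and "\<And>\<beta>. fps_nth (expand (Poly_Mapping.lookup v \<beta>)) 0 = (if \<beta> = \<gamma> then 1 else 0)"
  shows "v - ebasis \<gamma> \<in> fil 1"
  using assms V_diff[OF v V_ebasis[OF \<gamma>]]
  by (simp add: fil_def mem_ord_ge_1 lookup_minus expand_diff ebasis_def lookup_single when_def)

text \<open>At \<open>x = y = 1\<close> the coefficients \<open>y\<close> and \<open>1 - y\<close>
  become 1 and 0 and \<open>T\<close> vanishes, leaving the basis vector of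
  \<open>refl s \<beta>\<close>. For \<beta> = \<alpha>_s instead \<open>\<phi>\<close> contributes
  0 and the \<open>T\<close> term contributes 1.\<close>

lemma psi_ebasis_mod:
  assumes s: "s \<in> S" and \<beta>: "\<beta> \<in> pos"
  shows "paris_psi S M s (ebasis \<beta>) - ebasis (abs_root (refl s \<beta>)) \<in> fil 1"
proof (rule ebasis_diff_fil)
  show "paris_psi S M s (ebasis \<beta>) \<in> V"
    by (rule psi_V[OF s V_ebasis[OF \<beta>]])
  show "abs_root (refl s \<beta>) \<in> pos"
    by (rule abs_root_pos[OF refl_in_roots[OF s pos_root[OF \<beta>]]])
next
  fix \<gamma>
  have T: "fps_nth (expand (poly_at_ly (paris_T S M s \<beta>))) 0 = (if \<beta> = simple_root s then 1 else 0)"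
    using paris_T_at_1[OF s \<beta>] by (simp add: expand_poly_at_ly_0)
  note basis = paris_psi_basis_def paris_phi_basis_def Let_def ebasis_def
    lookup_add lookup_single expand_add expand_mult expand_diff when_def
  show "fps_nth (expand (Poly_Mapping.lookup (paris_psi S M s (ebasis \<beta>)) \<gamma>)) 0 =
      (if \<gamma> = abs_root (refl s \<beta>) then 1 else 0)"
  proof (cases "\<beta> = simple_root s")
    case True
    have "abs_root (refl s \<beta>) = simple_root s"
      using True s abs_root_uminus[of "simple_root s"] simple_root_pos[OF s]
      by (simp add: refl_simple_self pos_root) (simp add: abs_root_def)
    then show ?thesis
      unfolding paris_psi_ebasis[OF \<beta>] using True T by (auto simp: basis)
  next
    case False
    then have "abs_root (refl s \<beta>) = refl s \<beta>"
      using refl_pos[OF s \<beta>] by (simp add: abs_root_def)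
    then show ?thesis
      unfolding paris_psi_ebasis[OF \<beta>]
      using False by (cases "coroot s \<beta>" "0 :: real" rule: linorder_cases)
        (auto simp: basis T reflection_def single_uminus)
  qed
qed

text \<open>For the inverse letter, take the congruence for the generator at
  \<open>abs_root (refl s \<beta>)\<close>, which \<open>s\<close> carries back to \<beta> up to
  sign, and apply the inverse to it; \<open>Psi_fil\<close> keeps the error in
  \<open>fil 1\<close>.\<close>

lemma Psi_letter_mod:
  assumes s: "s \<in> S" and \<beta>: "\<beta> \<in> pos"
  shows "\<Psi> (cls [(s, b)]) (ebasis \<beta>) - ebasis (abs_root (refl s \<beta>)) \<in> fil 1"
proof (cases b)
  case True
  then show ?thesis using psi_ebasis_mod[OF assms] by (simp add: Psi_gen s)
next
  case False
  let ?\<gamma> = "abs_root (refl s \<beta>)"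
  let ?g = "cls [(s, False)]"
  have g: "?g \<in> carrier (artin_group S M)" "cls [(s, True)] \<in> carrier (artin_group S M)"
    using s by (simp_all add: carrier_artin)
  have \<gamma>: "?\<gamma> \<in> pos"
    by (rule abs_root_pos[OF refl_in_roots[OF s pos_root[OF \<beta>]]])
  have "abs_root (refl s ?\<gamma>) = \<beta>"
    using abs_root_refl[OF s refl_in_roots[OF s pos_root[OF \<beta>]]] s \<beta> by (simp add: abs_root_def)
  then have "paris_psi S M s (ebasis ?\<gamma>) - ebasis \<beta> \<in> fil 1"
    using psi_ebasis_mod[OF s \<gamma>] by simp
  then have "\<Psi> ?g (paris_psi S M s (ebasis ?\<gamma>) - ebasis \<beta>) \<in> fil 1"
    by (rule Psi_fil[OF g(1)])
  moreover have "\<Psi> ?g (paris_psi S M s (ebasis ?\<gamma>)) = ebasis ?\<gamma>"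
  proof -
    have "?g \<otimes>\<^bsub>artin_group S M\<^esub> cls [(s, True)] = \<one>\<^bsub>artin_group S M\<^esub>"
      using s pres_eq.cancel[of s S "artin_rels S M" False]
        pres_class_eq_iff[of "[(s, False), (s, True)]" S "artin_rels S M" "[]"]
      by (simp add: mult_artin one_artin)
    then show ?thesis
      using Psi_mult[OF g V_ebasis[OF \<gamma>]] Psi_one[OF V_ebasis[OF \<gamma>]] by (simp add: Psi_gen s)
  qed
  ultimately show ?thesis
    using False Psi_diff[OF g(1) psi_V[OF s V_ebasis[OF \<gamma>]] V_ebasis[OF \<beta>]] diff_fil_commute by simp
qed

lemma word_action_in_roots: "w \<in> gwords S \<Longrightarrow> \<beta> \<in> roots S M \<Longrightarrow> word_action S M w \<beta> \<in> roots S M"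
  by (induction w) (simp_all add: refl_in_roots)

lemma Psi_word_mod:
  assumes "w \<in> gwords S" and \<beta>: "\<beta> \<in> pos"
  shows "\<Psi> (cls w) (ebasis \<beta>) - ebasis (abs_root (word_action S M w \<beta>)) \<in> fil 1"
  using assms(1)
proof (induction w)
  case Nil
  then show ?case
    using Psi_one[OF V_ebasis[OF \<beta>]] \<beta> by (simp add: one_artin abs_root_def zero_fil)
next
  case (Cons a w)
  obtain s b where a: "a = (s, b)" by force
  have s: "s \<in> S" and w: "w \<in> gwords S" using Cons.prems a by simp_all
  let ?\<gamma> = "word_action S M w \<beta>"
  have \<gamma>: "?\<gamma> \<in> roots S M"
    by (rule word_action_in_roots[OF w pos_root[OF \<beta>]])
  have g: "cls [a] \<in> carrier (artin_group S M)" "cls w \<in> carrier (artin_group S M)"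
    using s w a by (simp_all add: carrier_artin)
  have "\<Psi> (cls [a]) (\<Psi> (cls w) (ebasis \<beta>) - ebasis (abs_root ?\<gamma>)) \<in> fil 1"
    using Cons.IH[OF w] by (rule Psi_fil[OF g(1)])
  moreover have "\<Psi> (cls (a # w)) (ebasis \<beta>) = \<Psi> (cls [a]) (\<Psi> (cls w) (ebasis \<beta>))"
    using Psi_mult[OF g V_ebasis[OF \<beta>]] mult_artin[of "[a]" w] s w a by simp
  ultimately have "\<Psi> (cls (a # w)) (ebasis \<beta>) - \<Psi> (cls [a]) (ebasis (abs_root ?\<gamma>)) \<in> fil 1"
    using Psi_diff[OF g(1) Psi_V[OF g(2) V_ebasis[OF \<beta>]] V_ebasis[OF abs_root_pos[OF \<gamma>]]] by simp
  moreover have "\<Psi> (cls [a]) (ebasis (abs_root ?\<gamma>)) - ebasis (abs_root (refl s ?\<gamma>)) \<in> fil 1"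
    using Psi_letter_mod[OF s abs_root_pos[OF \<gamma>], of b] abs_root_refl[OF s \<gamma>] a by simp
  ultimately show ?case
    using diff_fil_trans a by simp
qed

section \<open>Unipotence of the pure Artin group\<close>

lemma pure_unipotent:
  assumes g: "g \<in> carrier (pure_artin_group S M)" and v: "v \<in> fil n"
  shows "\<Psi> g v - v \<in> fil (Suc n)"
proof -
  have ga: "g \<in> carrier (artin_group S M)"
    and gk: "artin_to_coxeter S M g = \<one>\<^bsub>coxeter_group S M\<^esub>"
    using g by (simp_all add: pure_artin_group_def kernel_def)
  obtain w where w: "w \<in> gwords S" "g = cls w"
    using ga by (auto simp: carrier_artin)
  \<comment> \<open>A word for a pure element is trivial in the Coxeter group, so it fixes every
    root and \<open>Psi_word_mod\<close> compares \<open>\<Psi> g\<close> with the identity.\<close>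
  have "pres_eq S (coxeter_rels S M) w []"
    using gk w pres_class_eq_iff[OF w(1), of "coxeter_rels S M" "[]"]
    by (simp add: artin_to_coxeter_class coxeter_group_def presented_group_def)
  then have "word_action S M w = word_action S M []"
    by (rule word_action_cong[OF finite_S coxeter small])
  then have "\<Psi> g (ebasis \<beta>) - ebasis \<beta> \<in> fil 1" if "\<beta> \<in> pos" for \<beta>
    using Psi_word_mod[OF w(1) that] w(2) that by (simp add: abs_root_def)
  then show ?thesis
    using lin_on_fil_diff[OF Psi_GL(2)[OF ga] lin_on_id v, of 1] by simp
qed

lemma pure_subset: "carrier (pure_artin_group S M) \<subseteq> carrier (artin_group S M)"
  by (auto simp: pure_artin_group_def kernel_def)

lemma unipotent_action_pure: "unipotent_action (pure_artin_group S M) fil \<Psi>"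
proof -
  interpret group "pure_artin_group S M" by (rule group_pure_artin_group)
  have one: "\<one>\<^bsub>pure_artin_group S M\<^esub> = \<one>\<^bsub>artin_group S M\<^esub>"
    and mult: "(\<otimes>\<^bsub>pure_artin_group S M\<^esub>) = (\<otimes>\<^bsub>artin_group S M\<^esub>)"
    by (simp_all add: pure_artin_group_def)
  show ?thesis
  proof (unfold_locales)
    fix v n m assume v: "v \<in> fil 0" and m: "0 < m" and mv: "(\<Sum>i<m::nat. v) \<in> fil n"
    then show "v \<in> fil n"
      using ord_ge_isolated[OF m] by (auto simp: fil_def lookup_sum simp del: sum_constant)
  next
    fix v assume v: "\<And>n. v \<in> fil n"
    show "v = 0"
    proof (rule poly_mapping_eqI)
      fix \<beta>
      have "Poly_Mapping.lookup v \<beta> \<in> ord_ge n" for n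
        using v[of n] by (simp add: fil_def)
      then show "Poly_Mapping.lookup v \<beta> = Poly_Mapping.lookup 0 \<beta>"
        using Inter_ord_ge by simp
    qed
  next
    fix g assume "g \<in> carrier (pure_artin_group S M)" and "\<And>v. v \<in> fil 0 \<Longrightarrow> \<Psi> g v = v"
    then show "g = \<one>\<^bsub>pure_artin_group S M\<^esub>"
      unfolding one fil_0 using Psi_faithful pure_subset by blast
  next
    fix n show "fil (Suc n) \<subseteq> fil n"
      using ord_ge_Suc by (auto simp: fil_def)
  qed (simp_all add: zero_fil diff_fil pure_unipotent fil_0 one mult Psi_one Psi_mult Psi_diff
      subsetD[OF pure_subset])
qed

end

theorem theorem1p3:
  fixes S :: "'s set" and M :: "'s \<Rightarrow> 's \<Rightarrow> enat"
    and \<Psi> :: "'s gword set \<Rightarrow> (('s \<Rightarrow>\<^sub>0 real) \<Rightarrow>\<^sub>0 laurent2) \<Rightarrow> (('s \<Rightarrow>\<^sub>0 real) \<Rightarrow>\<^sub>0 laurent2)"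
  assumes "finite S"
    and "coxeter_matrix S M" and "small_matrix S M" and "triangle_free_matrix S M"
    and "paris_representation S M \<Psi>"
    and "inj_on \<Psi> (carrier (artin_group S M))"
  shows "residually_torsion_free_nilpotent (pure_artin_group S M)"
proof -
  interpret faithful_paris S M \<Psi>
    using assms by unfold_locales
  show ?thesis
    by (rule unipotent_action.residually_torsion_free_nilpotent[OF unipotent_action_pure])
qed

end
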